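(* Let $\nu\in(0,1)$, $h,\lambda>0$ and $c>0$. Let $\{T_n^{(\nu)}:n\geq 1\}$ be i.i.d. random variables with density $f_{\nu,h,\lambda}(t)=\lambda^h t^{\nu h-1}E_{\nu,\nu h}^h(-\lambda t^\nu)1_{(0,\infty)}(t)$ and law $P_T$, and let $M_{\nu,h,\lambda}(t):=\sum_{n\geq 1}1_{T_1^{(\nu)}+\cdots+T_n^{(\nu)}\leq t}$ for $t\geq 0$. Let $\{U_k:k\geq 1\}$ be i.i.d. positive random variables with law $P_U$, independent of $\{T_n^{(\nu)}:n\geq 1\}$. For $u>0$ let $$\Psi(u):=P\left(\exists\, t\geq 0: u+ct-\sum_{k=1}^{M_{\nu,h,\lambda}(t)}U_k<0\right)=P\left(\exists\, n\geq 1:\sum_{k=1}^n(U_k-cT_k^{(\nu)})>u\right).$$ Define $\tilde{\kappa}_\nu(\theta):=\log\mathbb{E}[e^{\theta U_1}]+\log\mathbb{E}[e^{-c\theta T_1^{(\nu)}}]$ for $\theta\in\mathbb{R}$, and assume that there exists $w_{\nu,h,\lambda}\in(0,\infty)\cap\{\theta\in\mathbb{R}:\tilde{\kappa}_\nu(\theta)<\infty\}^\circ$ such that $\tilde{\kappa}_\nu(w_{\nu,h,\lambda})=0$. For each $\theta$ with $\tilde{\kappa}_\nu(\theta)<\infty$ let $P_U^\theta\otimes P_T^\theta$ be the product law given by $$\frac{dP_U^\theta}{dP_U}(x)=e^{\theta x-\log\mathbb{E}[e^{\theta U_1}]},\qquad \frac{dP_T^\theta}{dP_T}(t)=e^{-c\theta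 t-\log\mathbb{E}[e^{-c\theta T_1^{(\nu)}}]}.$$ Then, for $\theta=w_{\nu,h,\lambda}$, $P_U^\theta\otimes P_T^\theta$ is an (asymptotically) optimal importance sampling distribution for the estimation of $\Psi(u)$ by simulation for large values of $u$.
   Context: Generalized Mittag-Leffler function: $E_{\alpha,\beta}^\gamma(x):=\sum_{r\geq 0}\frac{(\gamma)_r x^r}{r!\,\Gamma(\alpha r+\beta)}$, where $(\gamma)_0:=1$ and $(\gamma)_r:=\gamma(\gamma+1)\cdots(\gamma+r-1)$ for $r\geq 1$. $A^\circ$ denotes the interior of $A\subset\mathbb{R}$. It is known that $f_{\nu,h,\lambda}$ is a probability density and that, for $\nu\in(0,1)$, $\log\mathbb{E}[e^{\theta T_1^{(\nu)}}]=h\log\frac{\lambda}{\lambda+(-\theta)^\nu}$ if $\theta\leq 0$ and $=\infty$ if $\theta>0$. Importance sampling: let $Q$ be a probability law on $(0,\infty)^2$ with $P_U\otimes P_T$ absolutely continuous with respect to $Q$. Simulate the pairs $(U_n,T_n^{(\nu)})$, $n\geq 1$, as i.i.d. with common law $Q$ (expectation $\mathbb{E}_Q$), let $\tau_u:=\inf\{n\geq 1:\sum_{k=1}^n(U_k-cT_k^{(\nu)})>u\}$ (with $\inf\emptyset=\infty$), and consider the unbiased estimator of $\Psi(u)$ $$Z_u^Q:=1_{\{\tau_u<\infty\}}\prod_{k=1}^{\tau_u}\frac{d(P_U\otimes P_T)}{dQ}(U_k,T_k^{(\nu)}),\qquad \mathbb{E}_Q[Z_u^Q]=\Psi(u).$$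 By the Cauchy-Schwarz inequality $\mathbb{E}_Q[(Z_u^Q)^2]\geq\Psi(u)^2$ for every such $Q$. The law $Q$ is called an (asymptotically) optimal importance sampling distribution if its second moment has the best possible exponential decay rate, i.e. if $$\lim_{u\to\infty}\frac{1}{u}\log\mathbb{E}_Q[(Z_u^Q)^2]=2\lim_{u\to\infty}\frac{1}{u}\log\Psi(u),$$ where under the stated assumption the limit on the right-hand side exists and $\lim_{u\to\infty}\frac1u\log\Psi(u)=-w_{\nu,h,\lambda}$. *)

theory Defs
  imports "HOL-Probability.Probability"
begin

(* pochhammer is the rising factorial (gamma)_r. *)
definition mittag_leffler :: "real \<Rightarrow> real \<Rightarrow> real \<Rightarrow> real \<Rightarrow> real" where
  "mittag_leffler \<alpha> \<beta> \<gamma> x =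
     (\<Sum>r. pochhammer \<gamma> r * x ^ r / (fact r * Gamma (\<alpha> * real r + \<beta>)))"

definition waiting_density :: "real \<Rightarrow> real \<Rightarrow> real \<Rightarrow> real \<Rightarrow> real" where
  "waiting_density \<nu> h lam t =
     lam powr h * t powr (\<nu> * h - 1) * mittag_leffler \<nu> (\<nu> * h) h (- lam * t powr \<nu>)
       * indicator {0<..} t"

(* The real ln is total with ln 0 = 0, which would be wrong for expectations that vanish or
   diverge; hence an extended logarithm with log 0 = -\<infinity> and log \<infinity> = \<infinity>. *)
definition elog :: "ennreal \<Rightarrow> ereal" where
  "elog x = (if x = 0 then - \<infinity> else if x = \<infinity> then \<infinity> else ereal (ln (enn2real x)))"

definition log_mgf :: "'a measure \<Rightarrow> ('a \<Rightarrow> real) \<Rightarrow> real \<Rightarrow> ereal" where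
  "log_mgf M X \<theta> = elog (\<integral>\<^sup>+ \<omega>. ennreal (exp (\<theta> * X \<omega>)) \<partial>M)"

(* The exponential tilting of the law of X; meaningful when log_mgf M X \<theta> is finite. *)
definition tilted_law :: "'a measure \<Rightarrow> ('a \<Rightarrow> real) \<Rightarrow> real \<Rightarrow> real measure" where
  "tilted_law M X \<theta> =
     density (distr M borel X) (\<lambda>x. ennreal (exp (\<theta> * x - real_of_ereal (log_mgf M X \<theta>))))"

(* Almost surely finitely many renewals occur up to time t; on the exceptional null event
   card returns 0. *)
definition renewal_count :: "(nat \<Rightarrow> 'a \<Rightarrow> real) \<Rightarrow> 'a \<Rightarrow> real \<Rightarrow> nat" where
  "renewal_count T \<omega> t = card {n. 1 \<le> n \<and> (\<Sum>k=1..n. T k \<omega>) \<le> t}"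

definition ruin_probability ::
    "'a measure \<Rightarrow> real \<Rightarrow> (nat \<Rightarrow> 'a \<Rightarrow> real) \<Rightarrow> (nat \<Rightarrow> 'a \<Rightarrow> real) \<Rightarrow> real \<Rightarrow> real" where
  "ruin_probability M c U T u =
     measure M {\<omega> \<in> space M. \<exists>t\<ge>0. u + c * t - (\<Sum>k=1..renewal_count T \<omega> t. U k \<omega>) < 0}"

definition ruin_time :: "real \<Rightarrow> real \<Rightarrow> (nat \<Rightarrow> real \<times> real) \<Rightarrow> enat" where
  "ruin_time c u x = Inf (enat ` {n. 1 \<le> n \<and> (\<Sum>k=1..n. fst (x k) - c * snd (x k)) > u})"

(* P is the original law of a pair (claim size, waiting time), Q the simulation law;
   RN_deriv Q P is dP/dQ. *)
definition importance_estimator ::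
    "real \<Rightarrow> (real \<times> real) measure \<Rightarrow> (real \<times> real) measure \<Rightarrow> real \<Rightarrow> (nat \<Rightarrow> real \<times> real) \<Rightarrow> ennreal" where
  "importance_estimator c P Q u x =
     (case ruin_time c u x of
        enat n \<Rightarrow> (\<Prod>k=1..n. RN_deriv Q P (x k))
      | \<infinity> \<Rightarrow> 0)"

(* The moment depends only on the joint law of the simulated i.i.d. pairs, so they are realised
   as coordinates on the infinite product of copies of Q. *)
definition importance_second_moment ::
    "real \<Rightarrow> (real \<times> real) measure \<Rightarrow> (real \<times> real) measure \<Rightarrow> real \<Rightarrow> ennreal" where
  "importance_second_moment c P Q u = (\<integral>\<^sup>+ x. (importance_estimator c P Q u x)\<^sup>2 \<partial>(\<Pi>\<^sub>M n\<in>{1..}. Q))"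

(* Laws on (0,\<infinity>)^2 are Borel laws on the plane that give this quadrant mass one. *)
definition importance_sampling_law :: "(real \<times> real) measure \<Rightarrow> (real \<times> real) measure \<Rightarrow> bool" where
  "importance_sampling_law P Q \<longleftrightarrow>
     prob_space Q \<and> sets Q = sets (borel \<Otimes>\<^sub>M borel) \<and>
     emeasure Q ({0<..} \<times> {0<..}) = 1 \<and> absolutely_continuous Q P"

definition asymptotically_optimal ::
    "real \<Rightarrow> (real \<times> real) measure \<Rightarrow> (real \<Rightarrow> real) \<Rightarrow> (real \<times> real) measure \<Rightarrow> bool" where
  "asymptotically_optimal c P \<Psi> Q \<longleftrightarrow>
     importance_sampling_law P Q \<and>
     (\<exists>L. ((\<lambda>u. elog (ennreal (\<Psi> u)) / ereal u) \<longlongrightarrow> L) at_top \<and>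
          ((\<lambda>u. elog (importance_second_moment c P Q u) / ereal u) \<longlongrightarrow> 2 * L) at_top)"

end

theory Submission
  imports Defs "HOL-Real_Asymp.Real_Asymp"
begin

text \<open>Since the two log-moment generating functions cancel at the adjustment coefficient \<open>w\<close>, the
  tilted law has density \<open>exp (w X)\<close> for the net claim \<open>X = U - c T\<close>, and the estimator equals
  \<open>exp (- w S\<^sub>\<tau>)\<close> with \<open>S\<^sub>\<tau> > u\<close>. Hence its moments of order 1 (which is the ruin probability) and
  2 are at most \<open>exp (- p w u)\<close>. Conversely, under the tilted law the walk exceeds \<open>u\<close> within
  \<open>n = O(u)\<close> steps with probability tending to 1, by a Chernoff bound with exponent \<open>w / 2\<close>: the
  relevant moment generating function is that of \<open>X\<close> under the original law at \<open>w / 2\<close>, which is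
  less than 1 by strict convexity. As \<open>X\<close> has an exponential moment under the tilted law (\<open>w\<close> is
  interior), no step up to \<open>n\<close> is larger than \<open>d n\<close> with high probability, so that the overshoot
  is at most \<open>d n\<close> and both moments have rate \<open>- p w\<close>. Neither the drift nor a law of large
  numbers is needed.\<close>

section \<open>Product measures and independence\<close>

lemma nn_integral_Pair_mult:
  assumes "sigma_finite_measure N"
    and [measurable]: "f \<in> borel_measurable M" "g \<in> borel_measurable N"
  shows "(\<integral>\<^sup>+p. f (fst p) * g (snd p) \<partial>(M \<Otimes>\<^sub>M N)) = (\<integral>\<^sup>+x. f x \<partial>M) * (\<integral>\<^sup>+y. g y \<partial>N)"
proof -
  interpret sigma_finite_measure N by fact
  have "(\<integral>\<^sup>+p. f (fst p) * g (snd p) \<partial>(M \<Otimes>\<^sub>M N)) = (\<integral>\<^sup>+x. \<integral>\<^sup>+y. f x * g y \<partial>N \<partial>M)"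
    by (subst nn_integral_fst[symmetric]) auto
  also have "\<dots> = (\<integral>\<^sup>+x. f x * (\<integral>\<^sup>+y. g y \<partial>N) \<partial>M)"
    by (intro nn_integral_cong nn_integral_cmult) auto
  finally show ?thesis by (simp add: nn_integral_multc)
qed

lemma nn_integral_PiM_restrict:
  fixes f :: "('i \<Rightarrow> 'b) \<Rightarrow> ennreal"
  assumes M: "\<And>i. prob_space (M i)" and J: "finite J" "J \<subseteq> I"
    and f: "f \<in> borel_measurable (PiM J M)"
  shows "(\<integral>\<^sup>+x. f (restrict x J) \<partial>PiM I M) = (\<integral>\<^sup>+x. f x \<partial>PiM J M)"
proof -
  interpret product_prob_space M I
    using M by (simp add: product_prob_space_def product_prob_space_axioms_def
        product_sigma_finite_def prob_space_imp_sigma_finite)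
  have "(\<integral>\<^sup>+x. f x \<partial>PiM J M) = (\<integral>\<^sup>+x. f x \<partial>distr (PiM I M) (PiM J M) (\<lambda>x. restrict x J))"
    by (simp add: distr_PiM_restrict_finite J)
  also have "\<dots> = (\<integral>\<^sup>+x. f (restrict x J) \<partial>PiM I M)"
    by (rule nn_integral_distr) (use J f in \<open>auto intro: measurable_restrict_subset\<close>)
  finally show ?thesis by simp
qed

text \<open>Passing to the marginal on the finite set \<open>J\<close> leaves an integral over a
  finite product, where Tonelli factorises it.\<close>

lemma nn_integral_PiM_prod:
  assumes M: "\<And>i. prob_space (M i)" and J: "finite J" "J \<subseteq> I"
    and f [measurable]: "\<And>i. i \<in> J \<Longrightarrow> f i \<in> borel_measurable (M i)"
  shows "(\<integral>\<^sup>+x. (\<Prod>i\<in>J. f i (x i)) \<partial>PiM I M) = (\<Prod>i\<in>J. \<integral>\<^sup>+x. f i x \<partial>M i)"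
proof -
  interpret product_sigma_finite M
    using M by (simp add: product_sigma_finite_def prob_space_imp_sigma_finite)
  have "(\<integral>\<^sup>+x. (\<Prod>i\<in>J. f i (x i)) \<partial>PiM I M) =
        (\<integral>\<^sup>+x. (\<Prod>i\<in>J. f i (restrict x J i)) \<partial>PiM I M)"
    by (intro nn_integral_cong prod.cong) auto
  also have "\<dots> = (\<integral>\<^sup>+x. (\<Prod>i\<in>J. f i (x i)) \<partial>PiM J M)"
    by (rule nn_integral_PiM_restrict) (use M J in \<open>auto intro!: borel_measurable_prod\<close>)
  also have "\<dots> = (\<Prod>i\<in>J. \<integral>\<^sup>+x. f i x \<partial>M i)"
    by (rule product_nn_integral_prod) (use J in auto)
  finally show ?thesis .
qed

text \<open>Boxes determine a finite product measure, and on a box both the indicator and the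
  density are products of one-coordinate factors.\<close>

lemma PiM_density:
  assumes M: "\<And>i. prob_space (M i)" and N: "\<And>i. prob_space (density (M i) (r i))"
    and J: "finite J" and r [measurable]: "\<And>i. r i \<in> borel_measurable (M i)"
  shows "density (PiM J M) (\<lambda>x. \<Prod>i\<in>J. r i (x i)) = PiM J (\<lambda>i. density (M i) (r i))"
proof -
  interpret M: product_sigma_finite M
    using M by (simp add: product_sigma_finite_def prob_space_imp_sigma_finite)
  interpret N: product_sigma_finite "\<lambda>i. density (M i) (r i)"
    using N by (simp add: product_sigma_finite_def prob_space_imp_sigma_finite)
  show ?thesis
  proof (rule N.PiM_eqI[OF J])
    show "sets (density (PiM J M) (\<lambda>x. \<Prod>i\<in>J. r i (x i))) = sets (PiM J (\<lambda>i. density (M i) (r i)))"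
      using sets_PiM_cong[of J J "\<lambda>i. density (M i) (r i)" M] by simp
    fix A assume A: "\<And>i. i \<in> J \<Longrightarrow> A i \<in> sets (density (M i) (r i))"
    then have A' [measurable]: "\<And>i. i \<in> J \<Longrightarrow> A i \<in> sets (M i)" by simp
    have "emeasure (density (PiM J M) (\<lambda>x. \<Prod>i\<in>J. r i (x i))) (Pi\<^sub>E J A) =
        (\<integral>\<^sup>+x. (\<Prod>i\<in>J. r i (x i)) * indicator (Pi\<^sub>E J A) x \<partial>PiM J M)"
      by (rule emeasure_density) (use J A' in \<open>auto intro!: borel_measurable_prod sets_PiM_I_finite\<close>)
    also have "\<dots> = (\<integral>\<^sup>+x. (\<Prod>i\<in>J. r i (x i) * indicator (A i) (x i)) \<partial>PiM J M)"
    proof (rule nn_integral_cong)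
      fix x assume "x \<in> space (PiM J M)"
      then have "indicator (Pi\<^sub>E J A) x = (\<Prod>i\<in>J. indicator (A i) (x i) :: ennreal)"
        using J by (auto simp: indicator_def space_PiM PiE_iff prod_zero_iff)
      then show "(\<Prod>i\<in>J. r i (x i)) * indicator (Pi\<^sub>E J A) x = (\<Prod>i\<in>J. r i (x i) * indicator (A i) (x i))"
        by (simp add: prod.distrib)
    qed
    also have "\<dots> = (\<Prod>i\<in>J. \<integral>\<^sup>+x. r i x * indicator (A i) x \<partial>M i)"
      by (rule M.product_nn_integral_prod) (use J in auto)
    also have "\<dots> = (\<Prod>i\<in>J. emeasure (density (M i) (r i)) (A i))"
      by (intro prod.cong refl) (simp add: emeasure_density)
    finally show "emeasure (density (PiM J M) (\<lambda>x. \<Prod>i\<in>J. r i (x i))) (Pi\<^sub>E J A) =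
        (\<Prod>i\<in>J. emeasure (density (M i) (r i)) (A i))" .
  qed
qed

text \<open>Only finitely many coordinates are admitted because the infinite products themselves are in
  general mutually singular.\<close>

lemma nn_integral_PiM_change_of_measure:
  fixes f :: "('i \<Rightarrow> 'b) \<Rightarrow> ennreal"
  assumes M: "\<And>i. prob_space (M i)" and N: "\<And>i. prob_space (density (M i) (r i))"
    and J: "finite J" "J \<subseteq> I" and r [measurable]: "\<And>i. r i \<in> borel_measurable (M i)"
    and f [measurable]: "f \<in> borel_measurable (PiM J M)"
  shows "(\<integral>\<^sup>+x. (\<Prod>i\<in>J. r i (x i)) * f (restrict x J) \<partial>PiM I M) =
    (\<integral>\<^sup>+x. f (restrict x J) \<partial>PiM I (\<lambda>i. density (M i) (r i)))"
proof -
  have [measurable]: "(\<lambda>x. \<Prod>i\<in>J. r i (x i)) \<in> borel_measurable (PiM J M)"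
    using J by (auto intro!: borel_measurable_prod)
  have "(\<integral>\<^sup>+x. (\<Prod>i\<in>J. r i (x i)) * f (restrict x J) \<partial>PiM I M) =
      (\<integral>\<^sup>+x. (\<Prod>i\<in>J. r i (restrict x J i)) * f (restrict x J) \<partial>PiM I M)"
    by (intro nn_integral_cong arg_cong2[where f="(*)"] prod.cong) auto
  also have "\<dots> = (\<integral>\<^sup>+x. (\<Prod>i\<in>J. r i (x i)) * f x \<partial>PiM J M)"
    by (rule nn_integral_PiM_restrict) (use M J in auto)
  also have "\<dots> = (\<integral>\<^sup>+x. f x \<partial>density (PiM J M) (\<lambda>x. \<Prod>i\<in>J. r i (x i)))"
    by (rule nn_integral_density[symmetric]) auto
  also have "\<dots> = (\<integral>\<^sup>+x. f x \<partial>PiM J (\<lambda>i. density (M i) (r i)))"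
    using M N J by (subst PiM_density) auto
  also have "\<dots> = (\<integral>\<^sup>+x. f (restrict x J) \<partial>PiM I (\<lambda>i. density (M i) (r i)))"
  proof (rule nn_integral_PiM_restrict[symmetric])
    have "sets (PiM J (\<lambda>i. density (M i) (r i))) = sets (PiM J M)"
      by (rule sets_PiM_cong) auto
    then show "f \<in> borel_measurable (PiM J (\<lambda>i. density (M i) (r i)))"
      using f measurable_cong_sets by blast
  qed (use N J in auto)
  finally show ?thesis .
qed

text \<open>Rectangles generate the product sigma-algebra and are stable under intersection, so
  independence only has to be checked on them. There it follows from independence within each family
  and between the two families.\<close>

lemma (in prob_space) indep_vars_Pair:
  assumes X: "indep_vars M1 X I" and Y: "indep_vars M2 Y I"
    and XY: "indep_var (PiM I M1) (\<lambda>\<omega>. \<lambda>i\<in>I. X i \<omega>) (PiM I M2) (\<lambda>\<omega>. \<lambda>i\<in>I. Y i \<omega>)"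
  shows "indep_vars (\<lambda>i. M1 i \<Otimes>\<^sub>M M2 i) (\<lambda>i \<omega>. (X i \<omega>, Y i \<omega>)) I"
proof -
  have rvX [measurable]: "i \<in> I \<Longrightarrow> random_variable (M1 i) (X i)" for i
    using X by (auto simp: indep_vars_def2)
  have rvY [measurable]: "i \<in> I \<Longrightarrow> random_variable (M2 i) (Y i)" for i
    using Y by (auto simp: indep_vars_def2)
  define F where "F i = {(X i -` A \<inter> space M) \<inter> (Y i -` B \<inter> space M) | A B.
      A \<in> sets (M1 i) \<and> B \<in> sets (M2 i)}" for i
  have "indep_sets F I"
  proof (rule indep_setsI)
    show "F i \<subseteq> events" if "i \<in> I" for i
      unfolding F_def using that by (auto intro!: sets.Int measurable_sets)
    fix C J assume J: "J \<noteq> {}" "J \<subseteq> I" "finite J" and "\<forall>j\<in>J. C j \<in> F j"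
    then have "\<forall>j\<in>J. \<exists>A B. C j = (X j -` A \<inter> space M) \<inter> (Y j -` B \<inter> space M)
        \<and> A \<in> sets (M1 j) \<and> B \<in> sets (M2 j)"
      unfolding F_def by blast
    then obtain A B where C: "\<And>j. j \<in> J \<Longrightarrow> C j = (X j -` A j \<inter> space M) \<inter> (Y j -` B j \<inter> space M)"
      and A: "\<And>j. j \<in> J \<Longrightarrow> A j \<in> sets (M1 j)" and B: "\<And>j. j \<in> J \<Longrightarrow> B j \<in> sets (M2 j)"
      by metis
    \<comment> \<open>Cylinders over \<open>J\<close> turn the intersection over \<open>j\<close>
      into one event for each whole family, to which \<open>XY\<close> applies.\<close>
    let ?A = "prod_emb I M1 J (Pi\<^sub>E J A)" and ?B = "prod_emb I M2 J (Pi\<^sub>E J B)"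
    let ?X = "\<lambda>\<omega>. \<lambda>i\<in>I. X i \<omega>" and ?Y = "\<lambda>\<omega>. \<lambda>i\<in>I. Y i \<omega>"
    have eqA: "?X -` ?A \<inter> space M = (\<Inter>j\<in>J. X j -` A j \<inter> space M)"
      using J measurable_space[OF rvX] by (auto simp: prod_emb_def PiE_iff subset_eq)
    have eqB: "?Y -` ?B \<inter> space M = (\<Inter>j\<in>J. Y j -` B j \<inter> space M)"
      using J measurable_space[OF rvY] by (auto simp: prod_emb_def PiE_iff subset_eq)
    have "(\<Inter>j\<in>J. C j) = (\<lambda>\<omega>. (?X \<omega>, ?Y \<omega>)) -` (?A \<times> ?B) \<inter> space M"
    proof -
      have "(\<Inter>j\<in>J. C j) = (\<Inter>j\<in>J. X j -` A j \<inter> space M) \<inter> (\<Inter>j\<in>J. Y j -` B j \<inter> space M)"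
        using C by auto
      also have "\<dots> = (?X -` ?A \<inter> space M) \<inter> (?Y -` ?B \<inter> space M)"
        by (simp only: eqA eqB)
      finally show ?thesis by auto
    qed
    then have "prob (\<Inter>j\<in>J. C j) = prob (?X -` ?A \<inter> space M) * prob (?Y -` ?B \<inter> space M)"
      using indep_varD[OF XY, of ?A ?B] J A B by (simp add: sets_PiM_I)
    also have "\<dots> = (\<Prod>j\<in>J. prob (X j -` A j \<inter> space M)) * (\<Prod>j\<in>J. prob (Y j -` B j \<inter> space M))"
      unfolding eqA eqB using indep_varsD[OF X J(1,3,2) A] indep_varsD[OF Y J(1,3,2) B] by simp
    also have "\<dots> = (\<Prod>j\<in>J. prob (C j))"
      unfolding prod.distrib[symmetric]
    proof (rule prod.cong[OF refl])
      fix j assume j: "j \<in> J"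
      \<comment> \<open>One-coordinate cylinders extract the independence of \<open>X j\<close> and
        \<open>Y j\<close> from that of the families, which recombines the factors.\<close>
      let ?A = "prod_emb I M1 {j} (Pi\<^sub>E {j} A)" and ?B = "prod_emb I M2 {j} (Pi\<^sub>E {j} B)"
      have eqA: "?X -` ?A \<inter> space M = X j -` A j \<inter> space M"
        using J j measurable_space[OF rvX] by (auto simp: prod_emb_def PiE_iff subset_eq)
      have eqB: "?Y -` ?B \<inter> space M = Y j -` B j \<inter> space M"
        using J j measurable_space[OF rvY] by (auto simp: prod_emb_def PiE_iff subset_eq)
      have "C j = (\<lambda>\<omega>. (?X \<omega>, ?Y \<omega>)) -` (?A \<times> ?B) \<inter> space M"
        unfolding C[OF j] eqA[symmetric] eqB[symmetric] by auto
      then show "prob (X j -` A j \<inter> space M) * prob (Y j -` B j \<inter> space M) = prob (C j)"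
        using indep_varD[OF XY, of ?A ?B] j J A[OF j] B[OF j] unfolding eqA eqB
        by (simp add: sets_PiM_I subset_eq)
    qed
    finally show "prob (\<Inter>j\<in>J. C j) = (\<Prod>j\<in>J. prob (C j))" .
  qed
  then have "indep_sets (\<lambda>i. sigma_sets (space M) (F i)) I"
  proof (rule indep_sets_sigma)
    fix i show "Int_stable (F i)"
      unfolding Int_stable_def F_def
    proof safe
      fix A B A' B' assume "A \<in> sets (M1 i)" "B \<in> sets (M2 i)" "A' \<in> sets (M1 i)" "B' \<in> sets (M2 i)"
      then show "\<exists>A'' B''. X i -` A \<inter> space M \<inter> (Y i -` B \<inter> space M) \<inter> (X i -` A' \<inter> space M \<inter> (Y i -` B' \<inter> space M)) =
          X i -` A'' \<inter> space M \<inter> (Y i -` B'' \<inter> space M) \<and> A'' \<in> sets (M1 i) \<and> B'' \<in> sets (M2 i)"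
        by (intro exI[of _ "A \<inter> A'"] exI[of _ "B \<inter> B'"]) auto
    qed
  qed
  moreover have "{(\<lambda>\<omega>. (X i \<omega>, Y i \<omega>)) -` A \<inter> space M |A. A \<in> sets (M1 i \<Otimes>\<^sub>M M2 i)}
      \<subseteq> sigma_sets (space M) (F i)" if i: "i \<in> I" for i
  proof -
    let ?N = "sigma (space M) (F i)" and ?Z = "\<lambda>\<omega>. (X i \<omega>, Y i \<omega>)"
    have F: "F i \<subseteq> Pow (space M)" by (auto simp: F_def)
    have "?Z \<in> measurable ?N (M1 i \<Otimes>\<^sub>M M2 i)"
    proof (rule measurable_Pair)
      show "X i \<in> measurable ?N (M1 i)"
      proof (rule measurableI)
        fix A assume A: "A \<in> sets (M1 i)"
        \<comment> \<open>Taking the whole space for the other coordinate shows that preimages under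
          \<open>X i\<close> alone belong to \<open>F i\<close>.\<close>
        have "X i -` A \<inter> space M = (X i -` A \<inter> space M) \<inter> (Y i -` space (M2 i) \<inter> space M)"
          using measurable_space[OF rvY[OF i]] by auto
        then have "X i -` A \<inter> space M \<in> F i"
          unfolding F_def using A by blast
        then show "X i -` A \<inter> space ?N \<in> sets ?N" using F by auto
      qed (use measurable_space[OF rvX[OF i]] F in auto)
      show "Y i \<in> measurable ?N (M2 i)"
      proof (rule measurableI)
        fix A assume A: "A \<in> sets (M2 i)"
        have "Y i -` A \<inter> space M = (X i -` space (M1 i) \<inter> space M) \<inter> (Y i -` A \<inter> space M)"
          using measurable_space[OF rvX[OF i]] by auto
        then have "Y i -` A \<inter> space M \<in> F i"
          unfolding F_def using A by blast
        then show "Y i -` A \<inter> space ?N \<in> sets ?N" using F by auto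
      qed (use measurable_space[OF rvY[OF i]] F in auto)
    qed
    then show ?thesis using F by (auto dest!: measurable_sets)
  qed
  ultimately show ?thesis
    unfolding indep_vars_def2 by (auto intro: indep_sets_mono_sets)
qed

section \<open>The extended logarithm\<close>

text \<open>In \<open>ereal\<close> the sum of \<open>\<infinity>\<close> and
  \<open>- \<infinity>\<close> is \<open>\<infinity>\<close>, so a sum below
  \<open>\<infinity>\<close> rules out \<open>\<infinity>\<close> on either side.\<close>

lemma elog_add_finite:
  assumes "elog a + elog b < \<infinity>"
  shows "a < \<infinity>" "b < \<infinity>"
  using assms by (auto simp: elog_def less_top split: if_splits)

text \<open>A sum equal to 0 excludes both infinite values in both summands, so the extended
  logarithms are real ones.\<close>

lemma elog_add_eq_0:
  assumes "elog a + elog b = 0"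
  obtains x y where "a = ennreal x" "b = ennreal y" "0 < x" "0 < y"
    "elog a = ereal (ln x)" "elog b = ereal (ln y)" "ln x + ln y = 0"
proof -
  have fin: "a < \<infinity>" "b < \<infinity>" using elog_add_finite[of a b] assms by auto
  have ne: "a \<noteq> 0" "b \<noteq> 0" using assms fin by (auto simp: elog_def split: if_splits)
  show ?thesis
  proof
    show "a = ennreal (enn2real a)" "b = ennreal (enn2real b)" using fin by (auto simp: less_top)
    show "0 < enn2real a" "0 < enn2real b" using fin ne by (auto simp: enn2real_positive_iff zero_less_iff_neq_zero)
    show *: "elog a = ereal (ln (enn2real a))" "elog b = ereal (ln (enn2real b))"
      using fin ne by (auto simp: elog_def)
    show "ln (enn2real a) + ln (enn2real b) = 0"
      using assms unfolding * by simp
  qed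
qed

text \<open>Although \<open>d * (B * u + 1)\<close> is linear in \<open>u\<close>, its slope can be
  made arbitrarily small through \<open>d\<close> while \<open>B\<close> stays fixed, and the factor
  1/2 disappears after division by \<open>u\<close>.\<close>

lemma elog_rate:
  fixes F :: "real \<Rightarrow> ennreal"
  assumes a: "0 < a" and B: "0 \<le> B"
    and upper: "\<And>u. 0 < u \<Longrightarrow> F u \<le> ennreal (exp (- (a * u)))"
    and lower: "\<And>d. 0 < d \<Longrightarrow>
      eventually (\<lambda>u. ennreal (exp (- (a * (u + d * (B * u + 1)))) / 2) \<le> F u) at_top"
  shows "((\<lambda>u. elog (F u) / ereal u) \<longlongrightarrow> ereal (- a)) at_top"
proof -
  define g where "g u = ln (enn2real (F u)) / u" for u
  \<comment> \<open>The lower bound excludes 0 and the upper bound excludes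
    \<open>\<infinity>\<close>, so eventually \<open>elog\<close> is the real logarithm.\<close>
  have pos: "\<forall>\<^sub>F u in at_top. 0 < u \<and> 0 < enn2real (F u) \<and> F u < top"
    using lower[of 1, OF zero_less_one] eventually_gt_at_top[of 0]
  proof eventually_elim
    case (elim u)
    have "F u < top" using upper[OF elim(2)] by (rule le_less_trans) simp
    moreover have "0 < F u" using elim(1) by (rule less_le_trans[rotated]) simp
    ultimately show ?case using elim(2) by (simp add: enn2real_positive_iff)
  qed
  have "(g \<longlongrightarrow> - a) at_top"
  proof (rule tendstoI)
    fix e :: real assume e: "0 < e"
    \<comment> \<open>With this \<open>d\<close> the correction costs at most
      \<open>e / 2 * u\<close> once \<open>u \<ge> 1\<close>; the other \<open>e / 2 * u\<close>
      absorbs \<open>ln 2\<close>.\<close>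
    define d where "d = e / (2 * a * (B + 1))"
    have d: "0 < d" using a B e by (simp add: d_def)
    have dB: "a * d * (B + 1) = e / 2"
      using a B by (simp add: d_def divide_simps)
    show "\<forall>\<^sub>F u in at_top. dist (g u) (- a) < e"
      using pos lower[OF d] eventually_ge_at_top[of 1] eventually_gt_at_top[of "2 * ln 2 / e"]
    proof eventually_elim
      case (elim u)
      let ?F = "enn2real (F u)"
      have F: "F u = ennreal ?F" using elim by simp
      have "?F \<le> exp (- (a * u))"
        using upper[of u] elim by (subst (asm) F) (simp add: ennreal_le_iff)
      then have "ln ?F \<le> - (a * u)" using elim ln_le_cancel_iff[of ?F "exp (- (a * u))"] by simp
      then have 1: "g u \<le> - a" using elim unfolding g_def by (simp add: field_simps)
      have "exp (- (a * (u + d * (B * u + 1)))) / 2 \<le> ?F"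
        using elim(2) by (subst (asm) F) (simp add: ennreal_le_iff)
      then have "ln (exp (- (a * (u + d * (B * u + 1)))) / 2) \<le> ln ?F"
        using elim by (subst ln_le_cancel_iff) auto
      then have "- (a * (u + d * (B * u + 1))) - ln 2 \<le> ln ?F"
        by (simp add: ln_div)
      moreover have "a * (u + d * (B * u + 1)) \<le> a * u + e / 2 * u"
      proof -
        have "a * d * (B * u + 1) \<le> a * d * (B * u + u)"
          using elim a d by (intro mult_left_mono) auto
        also have "\<dots> = (a * d * (B + 1)) * u" by (simp add: algebra_simps)
        also have "\<dots> = e / 2 * u" by (simp only: dB)
        finally show ?thesis by (simp add: algebra_simps)
      qed
      moreover have "ln 2 < e / 2 * u" using elim(4) e by (simp add: field_simps)
      ultimately have "(- a - e) * u < ln ?F" by (simp add: algebra_simps)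
      then have "- a - e < g u" using elim unfolding g_def by (simp add: pos_less_divide_eq)
      with 1 show ?case by (simp add: dist_real_def)
    qed
  qed
  then have "((\<lambda>u. ereal (g u)) \<longlongrightarrow> ereal (- a)) at_top" by simp
  moreover have "\<forall>\<^sub>F u in at_top. ereal (g u) = elog (F u) / ereal u"
    using pos by eventually_elim (auto simp: g_def elog_def)
  ultimately show ?thesis by (rule Lim_transform_eventually)
qed

section \<open>The estimator under exponential tilting\<close>

definition net_claim :: "real \<Rightarrow> real \<times> real \<Rightarrow> real" where
  "net_claim c p = fst p - c * snd p"

text \<open>Starting \<open>m\<close> at 1 matches the infimum over \<open>n \<ge> 1\<close>. The
  event is phrased through the first \<open>n\<close> pairs only, so that it lives on a finite
  product.\<close>

definition first_passage :: "real \<Rightarrow> real \<Rightarrow> nat \<Rightarrow> (nat \<Rightarrow> real \<times> real) \<Rightarrow> bool" where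
  "first_passage c u n x \<longleftrightarrow> 1 \<le> n \<and> u < (\<Sum>k=1..n. net_claim c (x k)) \<and>
     (\<forall>m\<in>{1..<n}. (\<Sum>k=1..m. net_claim c (x k)) \<le> u)"

lemma measurable_net_claim [measurable]: "net_claim c \<in> borel_measurable (borel \<Otimes>\<^sub>M borel)"
  unfolding net_claim_def by measurable

lemma first_passage_unique: "first_passage c u n x \<Longrightarrow> first_passage c u m x \<Longrightarrow> n = m"
  unfolding first_passage_def by (metis atLeastLessThan_iff linorder_neqE_nat not_le)

text \<open>This is the stopping-time property that confines the change of measure to finitely many
  coordinates.\<close>

lemma first_passage_restrict:
  "first_passage c u n (restrict x {1..n}) \<longleftrightarrow> first_passage c u n x"
proof -
  have "(\<Sum>k=1..m. net_claim c (restrict x {1..n} k)) = (\<Sum>k=1..m. net_claim c (x k))" if "m \<le> n" for m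
    using that by (intro sum.cong) auto
  then show ?thesis unfolding first_passage_def by auto
qed

lemma ex_first_passage_iff:
  "(\<exists>n. first_passage c u n x) \<longleftrightarrow> (\<exists>n\<ge>1. u < (\<Sum>k=1..n. net_claim c (x k)))"
proof
  assume "\<exists>n\<ge>1. u < (\<Sum>k=1..n. net_claim c (x k))"
  then obtain n where n: "1 \<le> n \<and> u < (\<Sum>k=1..n. net_claim c (x k))"
    and min: "\<And>m. m < n \<Longrightarrow> \<not> (1 \<le> m \<and> u < (\<Sum>k=1..m. net_claim c (x k)))"
    using exists_least_iff[of "\<lambda>n. 1 \<le> n \<and> u < (\<Sum>k=1..n. net_claim c (x k))"] by blast
  then have "first_passage c u n x" unfolding first_passage_def by force
  then show "\<exists>n. first_passage c u n x" ..
qed (auto simp: first_passage_def)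

text \<open>A nonempty set of naturals has a least element, so the infimum in \<open>enat\<close> is
  attained; for the empty set it is \<open>\<infinity>\<close>.\<close>

lemma ruin_time_eq_enat_iff: "ruin_time c u x = enat n \<longleftrightarrow> first_passage c u n x"
proof -
  have *: "ruin_time c u x = enat n" if "first_passage c u n x" for n
    unfolding ruin_time_def
  proof (rule cInf_eq_minimum)
    show "enat n \<in> enat ` {n. 1 \<le> n \<and> u < (\<Sum>k=1..n. fst (x k) - c * snd (x k))}"
      using that by (auto simp: first_passage_def net_claim_def)
    fix y assume "y \<in> enat ` {n. 1 \<le> n \<and> u < (\<Sum>k=1..n. fst (x k) - c * snd (x k))}"
    then show "enat n \<le> y"
      using that by (fastforce simp: first_passage_def net_claim_def not_le[symmetric])
  qed
  show ?thesis
  proof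
    assume n: "ruin_time c u x = enat n"
    have "\<exists>m. first_passage c u m x"
    proof (rule ccontr)
      assume "\<not> ?thesis"
      then have *: "{n. 1 \<le> n \<and> u < (\<Sum>k=1..n. fst (x k) - c * snd (x k))} = {}"
        unfolding ex_first_passage_iff by (auto simp: net_claim_def)
      have "ruin_time c u x = \<infinity>"
        unfolding ruin_time_def * by (simp add: top_enat_def)
      with n show False by simp
    qed
    then show "first_passage c u n x" using * n by (metis enat.inject)
  qed (rule *)
qed

lemma importance_estimator_first_passage:
  assumes "first_passage c u n x"
  shows "importance_estimator c P Q u x = (\<Prod>k=1..n. RN_deriv Q P (x k))"
  using assms unfolding importance_estimator_def ruin_time_eq_enat_iff[symmetric] by simp

lemma importance_estimator_no_passage:
  assumes "\<And>n. \<not> first_passage c u n x"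
  shows "importance_estimator c P Q u x = 0"
proof -
  have "ruin_time c u x = \<infinity>"
    using assms unfolding ruin_time_eq_enat_iff[symmetric] by (cases "ruin_time c u x") auto
  then show ?thesis by (simp add: importance_estimator_def)
qed

text \<open>Passage indices are unique, so at most one summand survives, and the one for
  \<open>n = 0\<close> vanishes because passage requires \<open>1 \<le> n\<close>. The series form
  lets the likelihood ratio be integrated for each fixed \<open>n\<close>.\<close>

lemma importance_estimator_eq_suminf:
  "importance_estimator c P Q u x =
     (\<Sum>n. (\<Prod>k=1..n. RN_deriv Q P (x k)) * indicator {x. first_passage c u n x} x)"
proof (cases "\<exists>n. first_passage c u n x")
  case True
  then obtain n where n: "first_passage c u n x" ..
  have "(\<Sum>n. (\<Prod>k=1..n. RN_deriv Q P (x k)) * indicator {x. first_passage c u n x} x) =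
      (\<Sum>n\<in>{n}. (\<Prod>k=1..n. RN_deriv Q P (x k)) * indicator {x. first_passage c u n x} x)"
    using first_passage_unique[OF n] by (intro suminf_finite) (auto simp: indicator_def)
  then show ?thesis using n by (simp add: importance_estimator_first_passage)
next
  case False
  then show ?thesis by (simp add: importance_estimator_no_passage)
qed

section \<open>Exponential change of measure at the adjustment coefficient\<close>

locale lundberg_tilting =
  fixes P :: "(real \<times> real) measure" and c w :: real
  assumes prob_P: "prob_space P"
    and sets_P [measurable_cong, simp]: "sets P = sets (borel \<Otimes>\<^sub>M borel)"
    and w_pos: "0 < w"
    and mgf_w: "(\<integral>\<^sup>+p. ennreal (exp (w * net_claim c p)) \<partial>P) = 1"
begin

text \<open>The Esscher transform of \<open>P\<close>; by the Lundberg equation \<open>mgf_w\<close>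
  its normalising constant is 1.\<close>

definition Q :: "(real \<times> real) measure" where
  "Q = density P (\<lambda>p. ennreal (exp (w * net_claim c p)))"

lemma sets_Q [measurable_cong, simp]: "sets Q = sets (borel \<Otimes>\<^sub>M borel)"
  by (simp add: Q_def)

lemma space_Q [simp]: "space Q = UNIV"
  using sets_eq_imp_space_eq[OF sets_Q] by (simp add: space_pair_measure)

lemma nn_integral_Q:
  assumes [measurable]: "f \<in> borel_measurable (borel \<Otimes>\<^sub>M borel)"
  shows "(\<integral>\<^sup>+p. f p \<partial>Q) = (\<integral>\<^sup>+p. ennreal (exp (w * net_claim c p)) * f p \<partial>P)"
  unfolding Q_def by (rule nn_integral_density) measurable

text \<open>Tilting shifts the argument of the moment generating function by \<open>w\<close>. It is
  applied with \<open>a = - (w / 2)\<close> to small values of the walk and with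
  \<open>a = e\<close> to large jumps.\<close>

lemma nn_integral_Q_exp:
  "(\<integral>\<^sup>+p. ennreal (exp (a * net_claim c p)) \<partial>Q) =
   (\<integral>\<^sup>+p. ennreal (exp ((w + a) * net_claim c p)) \<partial>P)"
  by (subst nn_integral_Q)
     (auto intro!: nn_integral_cong simp: ennreal_mult[symmetric] exp_add[symmetric] distrib_right)

lemma prob_Q: "prob_space Q"
proof
  show "emeasure Q (space Q) = 1"
    using nn_integral_Q[of "\<lambda>_. 1"] mgf_w by simp
qed

text \<open>The tilting density is positive and finite, so its reciprocal leads back to
  \<open>P\<close>; this reciprocal is the likelihood ratio of the estimator.\<close>

lemma density_Q: "density Q (\<lambda>p. ennreal (exp (- (w * net_claim c p)))) = P"
  unfolding Q_def
  by (subst density_density_eq)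
     (auto simp: ennreal_mult[symmetric] exp_add[symmetric] density_1)

text \<open>\<open>RN_deriv\<close> is determined only up to null sets, so the explicit density is
  identified with it almost everywhere.\<close>

lemma AE_RN_deriv: "AE p in Q. RN_deriv Q P p = ennreal (exp (- (w * net_claim c p)))"
proof -
  interpret prob_space Q by (rule prob_Q)
  have "AE p in Q. ennreal (exp (- (w * net_claim c p))) = RN_deriv Q P p"
    by (rule RN_deriv_unique[OF _ density_Q]) measurable
  then show ?thesis by (auto elim!: eventually_mono)
qed

lemma absolutely_continuous_Q: "absolutely_continuous Q P"
  by (subst density_Q[symmetric]) (rule absolutely_continuousI_density, measurable)

abbreviation path_Q :: "(nat \<Rightarrow> real \<times> real) measure" where
  "path_Q \<equiv> \<Pi>\<^sub>M n\<in>{1..}. Q"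

lemma prob_path_Q: "prob_space path_Q"
  by (rule prob_space_PiM) (rule prob_Q)

text \<open>Countably many coordinates contribute countably many null sets, so one exceptional set
  serves all steps.\<close>

lemma AE_path_RN_deriv:
  "AE x in path_Q. \<forall>k\<in>{1..}. RN_deriv Q P (x k) = ennreal (exp (- (w * net_claim c (x k))))"
proof -
  have "AE x in path_Q. RN_deriv Q P (x k) = ennreal (exp (- (w * net_claim c (x k))))" if "k \<in> {1..}" for k
    by (rule AE_PiM_component[OF _ that AE_RN_deriv]) (rule prob_Q)
  then show ?thesis by (subst AE_ball_countable) auto
qed

lemma prod_RN_deriv:
  fixes x :: "nat \<Rightarrow> real \<times> real"
  assumes "\<forall>k\<in>{1..}. RN_deriv Q P (x k) = ennreal (exp (- (w * net_claim c (x k))))"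
  shows "(\<Prod>k=1..n. RN_deriv Q P (x k)) = ennreal (exp (- (w * (\<Sum>k=1..n. net_claim c (x k)))))"
proof -
  have "(\<Prod>k=1..n. RN_deriv Q P (x k)) = (\<Prod>k=1..n. ennreal (exp (- (w * net_claim c (x k)))))"
    using assms by (intro prod.cong) auto
  also have "\<dots> = ennreal (exp (\<Sum>k=1..n. - (w * net_claim c (x k))))"
    by (subst exp_sum) (auto simp: prod_ennreal)
  finally show ?thesis by (simp add: sum_negf sum_distrib_left)
qed

text \<open>At first passage the weight is \<open>exp (- (w * S))\<close> with the walk
  \<open>S\<close> above \<open>u\<close> and \<open>w > 0\<close>; without passage the estimator is
  0. The cases \<open>p = 1\<close> and \<open>p = 2\<close> concern the ruin probability and the
  second moment.\<close>

lemma estimator_moment_le: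
  "(\<integral>\<^sup>+x. importance_estimator c P Q u x ^ p \<partial>path_Q) \<le> ennreal (exp (- (real p * w * u)))"
  if "0 < p"
proof -
  interpret prob_space path_Q by (rule prob_path_Q)
  have "AE x in path_Q. importance_estimator c P Q u x ^ p \<le> ennreal (exp (- (real p * w * u)))"
    using AE_path_RN_deriv
  proof eventually_elim
    case (elim x)
    have "importance_estimator c P Q u x \<le> ennreal (exp (- (w * u)))"
    proof (cases "\<exists>n. first_passage c u n x")
      case True
      then obtain n where n: "first_passage c u n x" ..
      then have "importance_estimator c P Q u x = ennreal (exp (- (w * (\<Sum>k=1..n. net_claim c (x k)))))"
        unfolding importance_estimator_first_passage[OF n] by (intro prod_RN_deriv elim)
      also have "\<dots> \<le> ennreal (exp (- (w * u)))"
        using n w_pos by (auto simp: first_passage_def intro!: ennreal_leI)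
      finally show ?thesis .
    qed (simp add: importance_estimator_no_passage)
    then have "importance_estimator c P Q u x ^ p \<le> ennreal (exp (- (w * u))) ^ p"
      by (intro power_mono) auto
    also have "\<dots> = ennreal (exp (- (real p * w * u)))"
      by (simp add: ennreal_power exp_of_nat_mult[symmetric] mult.assoc)
    finally show ?case .
  qed
  then have "(\<integral>\<^sup>+x. importance_estimator c P Q u x ^ p \<partial>path_Q) \<le>
      (\<integral>\<^sup>+x. ennreal (exp (- (real p * w * u))) \<partial>path_Q)"
    by (rule nn_integral_mono_AE)
  then show ?thesis by (simp only: nn_integral_const emeasure_space_1 mult_1_right)
qed

section \<open>Measurability of the walk and of passage events\<close>

lemma measurable_walk:
  assumes "sets R = sets (borel \<Otimes>\<^sub>M borel)" "{1..m} \<subseteq> I"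
  shows "(\<lambda>x. \<Sum>k=1..m. net_claim c (x k)) \<in> borel_measurable (PiM I (\<lambda>_. R))"
proof (rule borel_measurable_sum)
  fix k assume "k \<in> {1..m}"
  then have [measurable]: "(\<lambda>x. x k) \<in> measurable (PiM I (\<lambda>_. R)) (borel \<Otimes>\<^sub>M borel)"
    using assms measurable_component_singleton[of k I "\<lambda>_. R"] measurable_cong_sets[OF refl assms(1)] by auto
  show "(\<lambda>x. net_claim c (x k)) \<in> borel_measurable (PiM I (\<lambda>_. R))" by measurable
qed

text \<open>\<open>R\<close> and \<open>I\<close> stay general because the event is needed over all
  coordinates under \<open>P\<close> and \<open>Q\<close>, and over the first \<open>n\<close>
  coordinates under \<open>Q\<close>.\<close>

lemma sets_first_passage:
  assumes "sets R = sets (borel \<Otimes>\<^sub>M borel)" "{1..n} \<subseteq> I"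
  shows "{x\<in>space (PiM I (\<lambda>_. R)). first_passage c u n x} \<in> sets (PiM I (\<lambda>_. R))"
proof -
  let ?N = "PiM I (\<lambda>_. R)"
  have S: "(\<lambda>x. \<Sum>k=1..m. net_claim c (x k)) \<in> borel_measurable ?N" if "m \<le> n" for m
    by (rule measurable_walk) (use assms that in auto)
  have "{x\<in>space ?N. u < (\<Sum>k=1..n. net_claim c (x k))} \<in> sets ?N"
    by (intro borel_measurable_less borel_measurable_const S) simp
  moreover have "{x\<in>space ?N. \<forall>m\<in>{1..<n}. (\<Sum>k=1..m. net_claim c (x k)) \<le> u} \<in> sets ?N"
    by (intro sets.sets_Collect_finite_All borel_measurable_le borel_measurable_const S) auto
  ultimately show ?thesis
    unfolding first_passage_def by (intro sets.sets_Collect_conj sets.sets_Collect_const)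
qed

lemma measurable_net_claim_P [measurable]: "net_claim c \<in> borel_measurable P"
  and measurable_net_claim_Q [measurable]: "net_claim c \<in> borel_measurable Q"
  by measurable

lemma measurable_coord: "1 \<le> k \<Longrightarrow> (\<lambda>x. x k) \<in> measurable path_Q (borel \<Otimes>\<^sub>M borel)"
  using measurable_component_singleton[of k "{1..}" "\<lambda>_. Q"] measurable_cong_sets[OF refl sets_Q] by auto

lemma measurable_net_claim_coord [measurable]:
  "1 \<le> k \<Longrightarrow> (\<lambda>x. net_claim c (x k)) \<in> borel_measurable path_Q"
  by (rule measurable_compose[OF measurable_coord measurable_net_claim])

lemmas measurable_net_claim_coord_Suc [measurable] = measurable_net_claim_coord[unfolded One_nat_def]

lemma measurable_walk_Q [measurable]: "(\<lambda>x. \<Sum>k=1..n. net_claim c (x k)) \<in> borel_measurable path_Q"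
  by (rule measurable_walk) auto

lemma sets_tame_passage:
  "{x\<in>space path_Q. u < (\<Sum>k=1..n. net_claim c (x k)) \<and> (\<forall>k\<in>{1..n}. net_claim c (x k) \<le> d)} \<in> sets path_Q"
proof -
  have "{x\<in>space path_Q. \<forall>k\<in>{1..n}. net_claim c (x k) \<le> d} \<in> sets path_Q"
    by (intro sets.sets_Collect_finite_All borel_measurable_le borel_measurable_const
        measurable_net_claim_coord) auto
  moreover have "{x\<in>space path_Q. u < (\<Sum>k=1..n. net_claim c (x k))} \<in> sets path_Q"
    by (intro borel_measurable_less borel_measurable_const measurable_walk_Q)
  ultimately show ?thesis by (intro sets.sets_Collect_conj)
qed

section \<open>Lower bound for the moments\<close>

text \<open>Just before first passage the walk is at most \<open>u\<close>, so the overshoot is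
  bounded by the last jump, which \<open>tame\<close> bounds by \<open>d\<close>.\<close>

lemma estimator_ge:
  assumes RN: "\<forall>k\<in>{1..}. RN_deriv Q P (x k) = ennreal (exp (- (w * net_claim c (x k))))"
    and u: "0 < u" and d: "0 \<le> d"
    and passage: "u < (\<Sum>k=1..n. net_claim c (x k))" and tame: "\<forall>k\<in>{1..n}. net_claim c (x k) \<le> d"
  shows "ennreal (exp (- (w * (u + d)))) \<le> importance_estimator c P Q u x"
proof -
  have n: "1 \<le> n" using passage u by (cases n) auto
  then obtain m where m: "first_passage c u m x"
    using passage ex_first_passage_iff[of c u x] by blast
  then have "m \<le> n" using passage n unfolding first_passage_def by (metis atLeastLessThan_iff not_le)
  obtain j where j: "m = Suc j" using m by (cases m) (auto simp: first_passage_def)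
  have "(\<Sum>k=1..j. net_claim c (x k)) \<le> u"
    \<comment> \<open>For \<open>j = 0\<close> the sum is empty and positivity of \<open>u\<close>
      is used, since \<open>first_passage\<close> does not constrain step 0.\<close>
    using m u unfolding first_passage_def j by (cases "j = 0") auto
  moreover have "net_claim c (x m) \<le> d" using tame \<open>m \<le> n\<close> j by auto
  ultimately have "(\<Sum>k=1..m. net_claim c (x k)) \<le> u + d" unfolding j by simp
  then have "ennreal (exp (- (w * (u + d)))) \<le> ennreal (exp (- (w * (\<Sum>k=1..m. net_claim c (x k)))))"
    using w_pos by (intro ennreal_leI) simp
  also have "\<dots> = importance_estimator c P Q u x"
    unfolding importance_estimator_first_passage[OF m] by (rule prod_RN_deriv[OF RN, symmetric])
  finally show ?thesis .
qed

text \<open>The estimator is nonnegative, so its moment may be bounded below by integrating over the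
  event that the walk exceeds \<open>u\<close> at step \<open>n\<close> without a jump above
  \<open>d\<close>.\<close>

lemma estimator_moment_ge:
  assumes u: "0 < u" and d: "0 \<le> d"
  shows "ennreal (exp (- (real p * w * (u + d)))) * emeasure path_Q
      {x\<in>space path_Q. u < (\<Sum>k=1..n. net_claim c (x k)) \<and> (\<forall>k\<in>{1..n}. net_claim c (x k) \<le> d)}
    \<le> (\<integral>\<^sup>+x. importance_estimator c P Q u x ^ p \<partial>path_Q)" (is "?e * emeasure _ ?G \<le> _")
proof -
  have "?e * emeasure path_Q ?G = (\<integral>\<^sup>+x. ?e * indicator ?G x \<partial>path_Q)"
    by (rule nn_integral_cmult_indicator[symmetric]) (rule sets_tame_passage)
  also have "\<dots> \<le> (\<integral>\<^sup>+x. importance_estimator c P Q u x ^ p \<partial>path_Q)"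
  proof (rule nn_integral_mono_AE)
    show "AE x in path_Q. ?e * indicator ?G x \<le> importance_estimator c P Q u x ^ p"
      using AE_path_RN_deriv
    proof eventually_elim
      case (elim x)
      show ?case
      proof (cases "x \<in> ?G")
        case True
        then have "ennreal (exp (- (w * (u + d)))) \<le> importance_estimator c P Q u x"
          using estimator_ge[OF elim u d] by blast
        then have "ennreal (exp (- (w * (u + d)))) ^ p \<le> importance_estimator c P Q u x ^ p"
          by (intro power_mono) auto
        moreover have "ennreal (exp (- (w * (u + d)))) ^ p = ?e"
          by (simp add: ennreal_power exp_of_nat_mult[symmetric] mult.assoc)
        ultimately show ?thesis using True by simp
      qed simp
    qed
  qed
  finally show ?thesis .
qed

section \<open>Tail estimates under the tilted law\<close>

text \<open>Chernoff bound for the lower tail under \<open>Q\<close> with exponent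
  \<open>w / 2\<close>; the moment generating function under \<open>Q\<close> at
  \<open>- (w / 2)\<close> is that under \<open>P\<close> at \<open>w / 2\<close>.\<close>

lemma prob_walk_le:
  "emeasure path_Q {x\<in>space path_Q. (\<Sum>k=1..n. net_claim c (x k)) \<le> u} \<le>
    ennreal (exp (w / 2 * u)) * (\<integral>\<^sup>+p. ennreal (exp (w / 2 * net_claim c p)) \<partial>P) ^ n"
  (is "emeasure _ ?A \<le> _")
proof -
  have A: "?A \<in> sets path_Q"
    by (intro borel_measurable_le borel_measurable_const measurable_walk_Q)
  have [measurable]: "(\<lambda>x. \<Prod>k=1..n. ennreal (exp (- (w / 2) * net_claim c (x k)))) \<in> borel_measurable path_Q"
    by (intro borel_measurable_prod_ennreal) auto
  have "emeasure path_Q ?A = (\<integral>\<^sup>+x. indicator ?A x \<partial>path_Q)" using A by simp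
  also have "\<dots> \<le> (\<integral>\<^sup>+x. ennreal (exp (w / 2 * u)) * (\<Prod>k=1..n. ennreal (exp (- (w / 2) * net_claim c (x k)))) \<partial>path_Q)"
  proof (rule nn_integral_mono)
    fix x
    have "(\<Prod>k=1..n. ennreal (exp (- (w / 2) * net_claim c (x k)))) =
        ennreal (exp (\<Sum>k=1..n. - (w / 2) * net_claim c (x k)))"
      by (simp add: prod_ennreal exp_sum)
    also have "(\<Sum>k=1..n. - (w / 2) * net_claim c (x k)) = - (w / 2) * (\<Sum>k=1..n. net_claim c (x k))"
      by (rule sum_distrib_left[symmetric])
    finally have *: "ennreal (exp (w / 2 * u)) * (\<Prod>k=1..n. ennreal (exp (- (w / 2) * net_claim c (x k)))) =
        ennreal (exp (w / 2 * (u - (\<Sum>k=1..n. net_claim c (x k)))))"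
      by (simp add: ennreal_mult[symmetric] exp_add[symmetric] right_diff_distrib)
    show "indicator ?A x \<le> ennreal (exp (w / 2 * u)) * (\<Prod>k=1..n. ennreal (exp (- (w / 2) * net_claim c (x k))))"
      unfolding * using w_pos by (auto simp: indicator_def ennreal_1[symmetric] simp del: ennreal_1 intro!: ennreal_leI)
  qed
  also have "\<dots> = ennreal (exp (w / 2 * u)) * (\<integral>\<^sup>+x. (\<Prod>k=1..n. ennreal (exp (- (w / 2) * net_claim c (x k)))) \<partial>path_Q)"
    by (rule nn_integral_cmult) measurable
  also have "(\<integral>\<^sup>+x. (\<Prod>k=1..n. ennreal (exp (- (w / 2) * net_claim c (x k)))) \<partial>path_Q) =
      (\<Prod>k=1..n. \<integral>\<^sup>+p. ennreal (exp (- (w / 2) * net_claim c p)) \<partial>Q)"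
    by (rule nn_integral_PiM_prod) (auto simp: prob_Q)
  also have "\<dots> = (\<integral>\<^sup>+p. ennreal (exp (w / 2 * net_claim c p)) \<partial>P) ^ n"
    by (subst nn_integral_Q_exp) simp
  finally show ?thesis .
qed

text \<open>Union bound over the steps and Markov's inequality with exponent \<open>e\<close>; the
  shift by \<open>w\<close> converts the moment under \<open>Q\<close> into one under
  \<open>P\<close>.\<close>

lemma prob_large_jump:
  assumes e: "0 < e"
  shows "emeasure path_Q {x\<in>space path_Q. \<exists>k\<in>{1..n}. d < net_claim c (x k)} \<le>
    of_nat n * (ennreal (exp (- (e * d))) * (\<integral>\<^sup>+p. ennreal (exp ((w + e) * net_claim c p)) \<partial>P))"
  (is "emeasure _ ?A \<le> _")
proof -
  have A: "?A \<in> sets path_Q"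
    by (intro sets.sets_Collect_finite_Ex borel_measurable_less borel_measurable_const
        measurable_net_claim_coord) auto
  have "emeasure path_Q ?A = (\<integral>\<^sup>+x. indicator ?A x \<partial>path_Q)" using A by simp
  also have "\<dots> \<le> (\<integral>\<^sup>+x. (\<Sum>k=1..n. ennreal (exp (- (e * d))) * ennreal (exp (e * net_claim c (x k)))) \<partial>path_Q)"
  proof (rule nn_integral_mono)
    fix x
    show "indicator ?A x \<le> (\<Sum>k=1..n. ennreal (exp (- (e * d))) * ennreal (exp (e * net_claim c (x k))))"
    proof (cases "x \<in> ?A")
      case True
      then obtain k where k: "k \<in> {1..n}" "d < net_claim c (x k)" by blast
      have "1 \<le> ennreal (exp (e * (net_claim c (x k) - d)))"
        using k e by (auto simp: ennreal_1[symmetric] simp del: ennreal_1 intro!: ennreal_leI)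
      also have "\<dots> = ennreal (exp (- (e * d))) * ennreal (exp (e * net_claim c (x k)))"
        by (simp add: ennreal_mult[symmetric] exp_add[symmetric] right_diff_distrib)
      also have "\<dots> \<le> (\<Sum>k=1..n. ennreal (exp (- (e * d))) * ennreal (exp (e * net_claim c (x k))))"
        by (rule member_le_sum[OF k(1)]) auto
      finally show ?thesis using True by simp
    qed simp
  qed
  also have "\<dots> = (\<Sum>k=1..n. \<integral>\<^sup>+x. ennreal (exp (- (e * d))) * ennreal (exp (e * net_claim c (x k))) \<partial>path_Q)"
    by (rule nn_integral_sum) simp
  also have "\<dots> = (\<Sum>k=1..n. ennreal (exp (- (e * d))) * (\<integral>\<^sup>+p. ennreal (exp ((w + e) * net_claim c p)) \<partial>P))"
  proof (rule sum.cong[OF refl])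
    fix k assume k: "k \<in> {1..n}"
    have "(\<integral>\<^sup>+x. ennreal (exp (e * net_claim c (x k))) \<partial>path_Q) = (\<integral>\<^sup>+p. ennreal (exp (e * net_claim c p)) \<partial>Q)"
      using nn_integral_PiM_prod[of "\<lambda>_. Q" "{k}" "{1..}" "\<lambda>_ p. ennreal (exp (e * net_claim c p))"] k prob_Q
      by simp
    then show "(\<integral>\<^sup>+x. ennreal (exp (- (e * d))) * ennreal (exp (e * net_claim c (x k))) \<partial>path_Q) =
        ennreal (exp (- (e * d))) * (\<integral>\<^sup>+p. ennreal (exp ((w + e) * net_claim c p)) \<partial>P)"
      using k by (subst nn_integral_cmult) (auto simp: nn_integral_Q_exp)
  qed
  finally show ?thesis by simp
qed

text \<open>Let \<open>y = exp (w / 2 * X)\<close> for the net claim \<open>X\<close>. The mean of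
  \<open>y\<^sup>2\<close> is 1 by \<open>mgf_w\<close>, so expanding the mean of
  \<open>(y - 1)\<^sup>2\<close> shows that a mean of \<open>y\<close> of at least 1 forces
  \<open>y = 1\<close> almost everywhere.\<close>

lemma half_mgf_less_1:
  assumes nondeg: "\<not> (AE p in P. net_claim c p = 0)"
  shows "(\<integral>\<^sup>+p. ennreal (exp (w / 2 * net_claim c p)) \<partial>P) < 1" (is "?q < 1")
proof (rule ccontr)
  interpret prob_space P by (rule prob_P)
  assume "\<not> ?q < 1"
  then have "2 \<le> 2 * ?q" using mult_left_mono[of 1 ?q 2] by (simp add: not_less)
  let ?s = "\<lambda>p. ennreal ((exp (w / 2 * net_claim c p) - 1)\<^sup>2)"
  \<comment> \<open>The expansion of the square is arranged as a sum, because subtraction in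
    \<open>ennreal\<close> is truncated.\<close>
  have "2 * ?q + (\<integral>\<^sup>+p. ?s p \<partial>P) = (\<integral>\<^sup>+p. 2 * ennreal (exp (w / 2 * net_claim c p)) + ?s p \<partial>P)"
    by (simp add: nn_integral_add nn_integral_cmult)
  also have "\<dots> = (\<integral>\<^sup>+p. ennreal (exp (w * net_claim c p)) + 1 \<partial>P)"
  proof (rule nn_integral_cong)
    fix p
    let ?y = "exp (w / 2 * net_claim c p)"
    have "?y * ?y = exp (w * net_claim c p)" by (simp add: exp_add[symmetric])
    then have "2 * ?y + (?y - 1)\<^sup>2 = exp (w * net_claim c p) + 1"
      by (simp add: power2_eq_square algebra_simps)
    moreover have "2 * ennreal ?y + ?s p = ennreal (2 * ?y + (?y - 1)\<^sup>2)"
      by (simp add: ennreal_plus ennreal_mult)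
    ultimately show "2 * ennreal ?y + ?s p = ennreal (exp (w * net_claim c p)) + 1" by simp
  qed
  also have "\<dots> = 2" by (subst nn_integral_add) (auto simp: mgf_w emeasure_space_1)
  finally have sum: "2 * ?q + (\<integral>\<^sup>+p. ?s p \<partial>P) = 2" .
  then have "2 + (\<integral>\<^sup>+p. ?s p \<partial>P) \<le> 2 + 0"
    using \<open>2 \<le> 2 * ?q\<close> by (metis add.right_neutral add_right_mono)
  then have "(\<integral>\<^sup>+p. ?s p \<partial>P) = 0" by (subst (asm) ennreal_add_left_cancel_le) auto
  then have "AE p in P. ?s p = 0" by (subst (asm) nn_integral_0_iff_AE) auto
  then have "AE p in P. net_claim c p = 0"
    by eventually_elim (use w_pos in \<open>auto simp: ennreal_eq_0_iff\<close>)
  with nondeg show False by contradiction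
qed

section \<open>Unbiasedness of the estimator\<close>

text \<open>The measure is changed for each \<open>n\<close> separately, on the first
  \<open>n\<close> coordinates, which decide passage at step \<open>n\<close>. Summing over the
  disjoint passage events gives the probability of ever passing under the original law.\<close>

lemma estimator_mean:
  "(\<integral>\<^sup>+x. importance_estimator c P Q u x \<partial>path_Q) =
   emeasure (\<Pi>\<^sub>M n\<in>{1::nat..}. P) {x\<in>space (\<Pi>\<^sub>M n\<in>{1::nat..}. P). \<exists>n\<ge>1. u < (\<Sum>k=1..n. net_claim c (x k))}"
proof -
  interpret Q: prob_space Q by (rule prob_Q)
  let ?P = "\<Pi>\<^sub>M n\<in>{1::nat..}. P"
  let ?r = "RN_deriv Q P"
  have dens: "density Q ?r = P"
    by (rule Q.density_RN_deriv[OF absolutely_continuous_Q]) simp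
  have r: "?r \<in> borel_measurable (borel \<Otimes>\<^sub>M borel)"
    using borel_measurable_RN_deriv[of Q P] measurable_cong_sets[OF sets_Q refl] by blast
  have A: "{x\<in>space ?P. first_passage c u n x} \<in> sets ?P" for n
    by (rule sets_first_passage) auto
  have summand: "(\<integral>\<^sup>+x. (\<Prod>k=1..n. ?r (x k)) * indicator {x. first_passage c u n x} x \<partial>path_Q) =
      emeasure ?P {x\<in>space ?P. first_passage c u n x}" for n
  proof -
    let ?f = "indicator {x. first_passage c u n x} :: (nat \<Rightarrow> real \<times> real) \<Rightarrow> ennreal"
    have f: "?f \<in> borel_measurable (PiM {1..n} (\<lambda>_. Q))"
      using sets_first_passage[of Q n "{1..n}" u]
      by (intro borel_measurable_indicator_iff[THEN iffD2]) (auto simp: Collect_conj_eq Int_commute)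
    have restr: "?f (restrict x {1..n}) = ?f x" for x
      unfolding indicator_def mem_Collect_eq first_passage_restrict ..
    have "(\<integral>\<^sup>+x. (\<Prod>k=1..n. ?r (x k)) * ?f (restrict x {1..n}) \<partial>path_Q) =
        (\<integral>\<^sup>+x. ?f (restrict x {1..n}) \<partial>PiM {1..} (\<lambda>_. density Q ?r))"
      by (rule nn_integral_PiM_change_of_measure[OF _ _ _ _ _ f]) (auto simp: prob_Q dens prob_P)
    then have "(\<integral>\<^sup>+x. (\<Prod>k=1..n. ?r (x k)) * ?f x \<partial>path_Q) = (\<integral>\<^sup>+x. ?f x \<partial>?P)"
      by (simp only: restr dens)
    also have "\<dots> = (\<integral>\<^sup>+x. indicator {x\<in>space ?P. first_passage c u n x} x \<partial>?P)"
      by (intro nn_integral_cong) (auto simp: indicator_def)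
    finally show ?thesis using A by simp
  qed
  have "(\<integral>\<^sup>+x. importance_estimator c P Q u x \<partial>path_Q) =
      (\<Sum>n. \<integral>\<^sup>+x. (\<Prod>k=1..n. ?r (x k)) * indicator {x. first_passage c u n x} x \<partial>path_Q)"
    unfolding importance_estimator_eq_suminf
  proof (rule nn_integral_suminf)
    fix n
    have "{x. first_passage c u n x} \<inter> space path_Q \<in> sets path_Q"
      using sets_first_passage[of Q n "{1..}" u] by (auto simp: Collect_conj_eq Int_commute)
    moreover have "(\<lambda>x. \<Prod>k=1..n. ?r (x k)) \<in> borel_measurable path_Q"
      by (intro borel_measurable_prod_ennreal measurable_compose[OF measurable_coord r]) auto
    ultimately show "(\<lambda>x. (\<Prod>k=1..n. ?r (x k)) * indicator {x. first_passage c u n x} x) \<in> borel_measurable path_Q"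
      by (intro borel_measurable_times_ennreal borel_measurable_indicator_iff[THEN iffD2])
  qed
  also have "\<dots> = (\<Sum>n. emeasure ?P {x\<in>space ?P. first_passage c u n x})"
    by (simp only: summand)
  also have "\<dots> = emeasure ?P (\<Union>n. {x\<in>space ?P. first_passage c u n x})"
    by (rule suminf_emeasure) (use A first_passage_unique in \<open>auto simp: disjoint_family_on_def\<close>)
  also have "(\<Union>n. {x\<in>space ?P. first_passage c u n x}) =
      {x\<in>space ?P. \<exists>n\<ge>1. u < (\<Sum>k=1..n. net_claim c (x k))}"
    using ex_first_passage_iff[of c u] by blast
  finally show ?thesis .
qed

section \<open>Exponential rate of the moments\<close>

text \<open>A number \<open>n\<close> of steps of order \<open>u\<close> makes the Chernoff bound
  small, while the threshold \<open>d * n\<close>, linear in \<open>n\<close>, makes the union bound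
  for large jumps small. \<open>B\<close> is fixed before \<open>d\<close>, as
  \<open>elog_rate\<close> requires.\<close>

lemma tame_passage_eventually_likely:
  assumes nondeg: "\<not> (AE p in P. net_claim c p = 0)"
    and e: "0 < e" and fin: "(\<integral>\<^sup>+p. ennreal (exp ((w + e) * net_claim c p)) \<partial>P) < \<infinity>"
  obtains B where "0 < B" and "\<And>d. 0 < d \<Longrightarrow> \<forall>\<^sub>F u in at_top. ennreal (1 / 2) \<le>
    emeasure path_Q {x\<in>space path_Q. u < (\<Sum>k=1..nat \<lceil>B * u\<rceil>. net_claim c (x k)) \<and>
      (\<forall>k\<in>{1..nat \<lceil>B * u\<rceil>}. net_claim c (x k) \<le> d * real (nat \<lceil>B * u\<rceil>))}"
proof -
  interpret path: prob_space path_Q by (rule prob_path_Q)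
  define q where "q = (\<integral>\<^sup>+p. ennreal (exp (w / 2 * net_claim c p)) \<partial>P)"
  define K where "K = enn2real (\<integral>\<^sup>+p. ennreal (exp ((w + e) * net_claim c p)) \<partial>P)"
  have K: "(\<integral>\<^sup>+p. ennreal (exp ((w + e) * net_claim c p)) \<partial>P) = ennreal K" "0 \<le> K"
    using fin by (auto simp: K_def less_top)
  \<comment> \<open>The maximum with 1/2 keeps \<open>r\<close> positive, so that
    \<open>ln r\<close> is a genuine logarithm, and a negative one.\<close>
  define r where "r = max (enn2real q) (1 / 2)"
  have q: "q < 1" unfolding q_def by (rule half_mgf_less_1[OF nondeg])
  then have q_r: "q = ennreal (enn2real q)" by (simp add: less_top order_less_trans)
  have r: "0 < r" "r < 1"
    using q by (auto simp: r_def enn2real_less_iff less_max_iff_disj) (subst (asm) q_r, simp add: ennreal_less_one_iff)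
  have q_le: "q \<le> ennreal r" by (subst q_r) (simp add: r_def ennreal_leI)
  \<comment> \<open>\<open>B\<close> is chosen so that \<open>r ^ n \<le> exp (- w * u)\<close> for
    \<open>n \<ge> B * u\<close>; half of this exponent pays for the Chernoff factor
    \<open>exp (w / 2 * u)\<close>.\<close>
  define B where "B = w / - ln r"
  have B: "0 < B" using w_pos r by (simp add: B_def divide_pos_neg)
  show ?thesis
  proof (rule that[OF B])
    fix d :: real assume d: "0 < d"
    have nB: "filterlim (\<lambda>u. nat \<lceil>B * u\<rceil>) at_top at_top"
      using B by real_asymp
    have "((\<lambda>m. real m * (exp (- (e * (d * real m))) * K)) \<longlongrightarrow> 0) at_top"
      using e d by real_asymp
    then have lim: "((\<lambda>u. real (nat \<lceil>B * u\<rceil>) * (exp (- (e * (d * real (nat \<lceil>B * u\<rceil>)))) * K)) \<longlongrightarrow> 0) at_top"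
      by (rule filterlim_compose[OF _ nB])
    have lim2: "((\<lambda>u. exp (- (w / 2 * u))) \<longlongrightarrow> 0) at_top"
      using w_pos by real_asymp
    \<comment> \<open>Each of the two bad events gets less than 1/4, which leaves at least 1/2 for
      the good one.\<close>
    have quarter: "(0::real) < 1 / 4" by simp
    show "\<forall>\<^sub>F u in at_top. ennreal (1 / 2) \<le>
      emeasure path_Q {x\<in>space path_Q. u < (\<Sum>k=1..nat \<lceil>B * u\<rceil>. net_claim c (x k)) \<and>
        (\<forall>k\<in>{1..nat \<lceil>B * u\<rceil>}. net_claim c (x k) \<le> d * real (nat \<lceil>B * u\<rceil>))}"
      using order_tendstoD(2)[OF lim quarter] order_tendstoD(2)[OF lim2 quarter] eventually_gt_at_top[of 0]
    proof eventually_elim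
      case (elim u)
      define n where "n = nat \<lceil>B * u\<rceil>"
      let ?A = "{x\<in>space path_Q. (\<Sum>k=1..n. net_claim c (x k)) \<le> u}"
      let ?J = "{x\<in>space path_Q. \<exists>k\<in>{1..n}. d * real n < net_claim c (x k)}"
      let ?G = "{x\<in>space path_Q. u < (\<Sum>k=1..n. net_claim c (x k)) \<and> (\<forall>k\<in>{1..n}. net_claim c (x k) \<le> d * real n)}"
      have sets: "?A \<in> sets path_Q" "?J \<in> sets path_Q" "?G \<in> sets path_Q"
        by (intro borel_measurable_le borel_measurable_const measurable_walk_Q)
           (intro sets.sets_Collect_finite_Ex borel_measurable_less borel_measurable_const
             measurable_net_claim_coord, auto intro: sets_tame_passage)
      have n: "B * u \<le> real n" unfolding n_def by (simp add: real_nat_ceiling_ge)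
      have "real n * ln r \<le> B * u * ln r" using n r by (intro mult_right_mono_neg) auto
      also have "\<dots> = - w * u" using r by (simp add: B_def)
      finally have "exp (real n * ln r) \<le> exp (- w * u)" by simp
      then have rn: "r ^ n \<le> exp (- w * u)" using r by (simp add: exp_of_nat_mult)
      have "emeasure path_Q ?A \<le> ennreal (exp (w / 2 * u)) * q ^ n"
        unfolding q_def by (rule prob_walk_le)
      also have "\<dots> \<le> ennreal (exp (w / 2 * u)) * ennreal r ^ n"
        by (intro mult_left_mono power_mono q_le) auto
      also have "\<dots> = ennreal (exp (w / 2 * u) * r ^ n)"
        using r by (simp add: ennreal_power ennreal_mult)
      also have "\<dots> \<le> ennreal (exp (w / 2 * u) * exp (- w * u))"
        using rn by (intro ennreal_leI mult_left_mono) auto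
      also have "exp (w / 2 * u) * exp (- w * u) = exp (- (w / 2 * u))"
        by (simp add: exp_add[symmetric])
      finally have "measure path_Q ?A \<le> exp (- (w / 2 * u))"
        by (simp only: path.emeasure_eq_measure ennreal_le_iff exp_ge_zero)
      then have A: "measure path_Q ?A < 1 / 4" using elim(2) by (rule le_less_trans)
      have "emeasure path_Q ?J \<le> of_nat n * (ennreal (exp (- (e * (d * real n)))) * ennreal K)"
        using prob_large_jump[OF e, where d="d * real n" and n=n] unfolding K .
      also have "\<dots> = ennreal (real n * (exp (- (e * (d * real n))) * K))"
        using K by (simp add: ennreal_mult ennreal_of_nat_eq_real_of_nat)
      finally have "measure path_Q ?J \<le> real n * (exp (- (e * (d * real n))) * K)"
        by (simp only: path.emeasure_eq_measure ennreal_le_iff mult_nonneg_nonneg of_nat_0_le_iff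
            exp_ge_zero K(2))
      then have J: "measure path_Q ?J < 1 / 4" using elim(1) unfolding n_def by (rule le_less_trans)
      have "1 = measure path_Q (?G \<union> (?A \<union> ?J))"
        by (subst path.prob_space[symmetric], rule arg_cong[of _ _ "measure path_Q"]) (auto simp: not_le not_less)
      also have "\<dots> \<le> measure path_Q ?G + (measure path_Q ?A + measure path_Q ?J)"
        using sets by (intro order_trans[OF measure_Un_le] add_left_mono measure_Un_le) auto
      finally have "1 / 2 \<le> measure path_Q ?G" using A J by simp
      then show ?case unfolding n_def path.emeasure_eq_measure by (rule ennreal_leI)
    qed
  qed
qed

text \<open>The overshoot allowance \<open>d * n\<close> is at most \<open>d * (B * u + 1)\<close>,
  where the 1 pays for rounding \<open>B * u\<close> up; this is the correction that
  \<open>elog_rate\<close> tolerates.\<close>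

lemma estimator_moment_rate:
  assumes p: "0 < p" and nondeg: "\<not> (AE p in P. net_claim c p = 0)"
    and e: "0 < e" and fin: "(\<integral>\<^sup>+p. ennreal (exp ((w + e) * net_claim c p)) \<partial>P) < \<infinity>"
  shows "((\<lambda>u. elog (\<integral>\<^sup>+x. importance_estimator c P Q u x ^ p \<partial>path_Q) / ereal u)
    \<longlongrightarrow> ereal (- (real p * w))) at_top"
proof -
  obtain B where B: "0 < B" and likely: "\<And>d. 0 < d \<Longrightarrow> \<forall>\<^sub>F u in at_top. ennreal (1 / 2) \<le>
    emeasure path_Q {x\<in>space path_Q. u < (\<Sum>k=1..nat \<lceil>B * u\<rceil>. net_claim c (x k)) \<and>
      (\<forall>k\<in>{1..nat \<lceil>B * u\<rceil>}. net_claim c (x k) \<le> d * real (nat \<lceil>B * u\<rceil>))}"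
    using tame_passage_eventually_likely[OF nondeg e fin] by blast
  show ?thesis
  proof (rule elog_rate[where B=B])
    fix d :: real assume d: "0 < d"
    show "\<forall>\<^sub>F u in at_top. ennreal (exp (- (real p * w * (u + d * (B * u + 1)))) / 2) \<le>
        (\<integral>\<^sup>+x. importance_estimator c P Q u x ^ p \<partial>path_Q)"
      using likely[OF d] eventually_gt_at_top[of 0]
    proof eventually_elim
      case (elim u)
      define n where "n = nat \<lceil>B * u\<rceil>"
      have n: "real n \<le> B * u + 1" unfolding n_def using B elim(2) by (simp add: of_int_ceiling_le_add_one)
      have "exp (- (real p * w * (u + d * (B * u + 1)))) \<le> exp (- (real p * w * (u + d * real n)))"
        using n d w_pos by (simp add: mult_left_mono)
      then have "ennreal (exp (- (real p * w * (u + d * (B * u + 1)))) / 2) \<le>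
          ennreal (exp (- (real p * w * (u + d * real n))) * (1 / 2))"
        by (intro ennreal_leI) simp
      also have "\<dots> = ennreal (exp (- (real p * w * (u + d * real n)))) * ennreal (1 / 2)"
        by (rule ennreal_mult) auto
      also have "\<dots> \<le> ennreal (exp (- (real p * w * (u + d * real n)))) * emeasure path_Q
          {x\<in>space path_Q. u < (\<Sum>k=1..n. net_claim c (x k)) \<and> (\<forall>k\<in>{1..n}. net_claim c (x k) \<le> d * real n)}"
        using elim(1) unfolding n_def by (intro mult_left_mono) auto
      also have "\<dots> \<le> (\<integral>\<^sup>+x. importance_estimator c P Q u x ^ p \<partial>path_Q)"
        using elim(2) d by (intro estimator_moment_ge) auto
      finally show ?case .
    qed
  next
    show "(\<integral>\<^sup>+x. importance_estimator c P Q u x ^ p \<partial>path_Q) \<le> ennreal (exp (- (real p * w * u)))" for u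
      by (rule estimator_moment_le[OF p])
  qed (use p w_pos B in auto)
qed

end

section \<open>Renewal counts and the ruin event\<close>

text \<open>Positivity makes the Laplace transform at 1 less than 1, so the probability that all
  partial sums stay below a bound is dominated by a vanishing geometric sequence. The partial sums
  are thus almost surely unbounded, and they increase.\<close>

lemma (in prob_space) AE_finite_renewals:
  fixes T :: "nat \<Rightarrow> 'a \<Rightarrow> real"
  assumes indep: "indep_vars (\<lambda>_. borel) T {1..}"
    and ident: "\<And>k. 1 \<le> k \<Longrightarrow> distr M borel (T k) = distr M borel (T 1)"
    and pos: "\<And>k. 1 \<le> k \<Longrightarrow> AE \<omega> in M. 0 < T k \<omega>"
  shows "AE \<omega> in M. \<forall>t. finite {n. 1 \<le> n \<and> (\<Sum>k=1..n. T k \<omega>) \<le> t}"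
proof -
  have rv [measurable]: "1 \<le> k \<Longrightarrow> T k \<in> borel_measurable M" for k
    using indep by (auto simp: indep_vars_def2)
  define f where "f = (\<integral>\<^sup>+\<omega>. ennreal (exp (- T 1 \<omega>)) \<partial>M)"
  have f_eq: "(\<integral>\<^sup>+\<omega>. ennreal (exp (- T k \<omega>)) \<partial>M) = f" if k: "1 \<le> k" for k
  proof -
    have "(\<integral>\<^sup>+\<omega>. ennreal (exp (- T k \<omega>)) \<partial>M) = (\<integral>\<^sup>+x. ennreal (exp (- x)) \<partial>distr M borel (T k))"
      using k by (subst nn_integral_distr) auto
    also have "\<dots> = f" unfolding ident[OF k] f_def by (subst nn_integral_distr) auto
    finally show ?thesis .
  qed
  have "f < 1"
  proof (rule ccontr)
    assume "\<not> f < 1"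
    \<comment> \<open>The variables \<open>exp (- T 1)\<close> and \<open>1 - exp (- T 1)\<close>
      add up to 1; if the first had mean at least 1, the second would vanish almost surely, against
      positivity.\<close>
    have "f + (\<integral>\<^sup>+\<omega>. ennreal (1 - exp (- T 1 \<omega>)) \<partial>M) =
        (\<integral>\<^sup>+\<omega>. ennreal (exp (- T 1 \<omega>)) + ennreal (1 - exp (- T 1 \<omega>)) \<partial>M)"
      unfolding f_def by (subst nn_integral_add) auto
    also have "\<dots> = (\<integral>\<^sup>+\<omega>. 1 \<partial>M)"
    proof (rule nn_integral_cong_AE)
      show "AE \<omega> in M. ennreal (exp (- T 1 \<omega>)) + ennreal (1 - exp (- T 1 \<omega>)) = 1"
        using pos[of 1, simplified] by eventually_elim (simp add: ennreal_plus[symmetric] del: ennreal_plus)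
    qed
    finally have "f + (\<integral>\<^sup>+\<omega>. ennreal (1 - exp (- T 1 \<omega>)) \<partial>M) = 1"
      by (simp add: emeasure_space_1)
    then have "1 + (\<integral>\<^sup>+\<omega>. ennreal (1 - exp (- T 1 \<omega>)) \<partial>M) \<le> 1 + 0"
      using \<open>\<not> f < 1\<close> by (metis add.right_neutral add_right_mono not_less)
    then have "(\<integral>\<^sup>+\<omega>. ennreal (1 - exp (- T 1 \<omega>)) \<partial>M) = 0"
      by (subst (asm) ennreal_add_left_cancel_le) auto
    then have "AE \<omega> in M. ennreal (1 - exp (- T 1 \<omega>)) = 0" by (subst (asm) nn_integral_0_iff_AE) auto
    with pos[of 1, simplified] have "AE \<omega> in M. False"
      by eventually_elim (simp add: ennreal_eq_0_iff)
    then show False by simp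
  qed
  have bounded_null: "AE \<omega> in M. \<not> (\<forall>n. (\<Sum>k=1..n. T k \<omega>) \<le> K)" for K
  proof -
    let ?N = "{\<omega>\<in>space M. \<forall>n. (\<Sum>k=1..n. T k \<omega>) \<le> K}"
    have S: "(\<lambda>\<omega>. \<Sum>k=1..n. T k \<omega>) \<in> borel_measurable M" for n
      by (rule borel_measurable_sum) simp
    have N: "?N \<in> sets M" using S by measurable
    have le: "emeasure M ?N \<le> ennreal (exp K) * f ^ n" for n
    proof -
      have "emeasure M ?N = (\<integral>\<^sup>+\<omega>. indicator ?N \<omega> \<partial>M)" using N by simp
      also have "\<dots> \<le> (\<integral>\<^sup>+\<omega>. ennreal (exp K) * ennreal (\<Prod>k=1..n. exp (- T k \<omega>)) \<partial>M)"
      proof (rule nn_integral_mono)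
        fix \<omega>
        have "(\<Prod>k=1..n. exp (- T k \<omega>)) = exp (- (\<Sum>k=1..n. T k \<omega>))"
          by (simp add: exp_sum sum_negf[symmetric])
        then have *: "ennreal (exp K) * ennreal (\<Prod>k=1..n. exp (- T k \<omega>)) = ennreal (exp (K - (\<Sum>k=1..n. T k \<omega>)))"
          by (simp add: ennreal_mult[symmetric] exp_add[symmetric])
        show "indicator ?N \<omega> \<le> ennreal (exp K) * ennreal (\<Prod>k=1..n. exp (- T k \<omega>))"
          unfolding * by (auto simp: indicator_def ennreal_1[symmetric] simp del: ennreal_1 intro!: ennreal_leI)
      qed
      also have "\<dots> = ennreal (exp K) * (\<integral>\<^sup>+\<omega>. (\<Prod>k=1..n. ennreal (exp (- T k \<omega>))) \<partial>M)"
        by (subst nn_integral_cmult) (auto simp: prod_ennreal intro!: borel_measurable_prod)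
      also have "(\<integral>\<^sup>+\<omega>. (\<Prod>k=1..n. ennreal (exp (- T k \<omega>))) \<partial>M) = (\<Prod>k=1..n. \<integral>\<^sup>+\<omega>. ennreal (exp (- T k \<omega>)) \<partial>M)"
      proof (rule indep_vars_nn_integral)
        show "indep_vars (\<lambda>_. borel) (\<lambda>k \<omega>. ennreal (exp (- T k \<omega>))) {1..n}"
          by (rule indep_vars_compose2[OF indep_vars_subset[OF indep]]) auto
      qed auto
      also have "\<dots> = f ^ n" by (simp add: f_eq)
      finally show ?thesis .
    qed
    obtain r where r: "0 \<le> r" "f = ennreal r" using \<open>f < 1\<close> by (cases f) auto
    then have "r < 1" using \<open>f < 1\<close> by (simp add: ennreal_less_one_iff)
    have "(\<lambda>n. f ^ n) \<longlonglongrightarrow> 0"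
      using tendsto_ennrealI[OF LIMSEQ_realpow_zero[OF r(1) \<open>r < 1\<close>]]
      by (simp only: r(2) ennreal_power[OF r(1)] ennreal_0)
    then have "(\<lambda>n. ennreal (exp K) * f ^ n) \<longlonglongrightarrow> ennreal (exp K) * 0"
      by (intro ennreal_tendsto_cmult) auto
    then have "emeasure M ?N \<le> ennreal (exp K) * 0"
      by (rule LIMSEQ_le_const) (intro exI[of _ 0] allI impI le)
    then have "emeasure M ?N = 0" by simp
    then show ?thesis by (rule AE_I[OF _ _ N, rotated]) blast
  qed
  have "AE \<omega> in M. \<forall>k\<in>{1..}. 0 < T k \<omega>"
    by (subst AE_ball_countable) (use pos in auto)
  \<comment> \<open>Natural bounds keep the union of null sets countable; a real \<open>t\<close>
    lies below one of them.\<close>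
  moreover have "AE \<omega> in M. \<forall>K::nat. \<not> (\<forall>n. (\<Sum>k=1..n. T k \<omega>) \<le> real K)"
    unfolding AE_all_countable by (intro allI bounded_null)
  ultimately show ?thesis
  proof eventually_elim
    case (elim \<omega>)
    show ?case
    proof
      fix t
      obtain K :: nat where K: "t \<le> real K" using real_arch_simple by blast
      obtain N where "\<not> (\<Sum>k=1..N. T k \<omega>) \<le> real K" using elim(2) by blast
      then have N: "real K < (\<Sum>k=1..N. T k \<omega>)" by (simp only: not_le)
      have "n \<le> N" if "(\<Sum>k=1..n. T k \<omega>) \<le> t" for n
      proof (rule ccontr)
        assume "\<not> n \<le> N"
        moreover have "0 \<le> T k \<omega>" if "k \<in> {1..n} - {1..N}" for k
          using bspec[OF elim(1), of k] that by simp
        ultimately have "(\<Sum>k=1..N. T k \<omega>) \<le> (\<Sum>k=1..n. T k \<omega>)"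
          by (intro sum_mono2) auto
        with N K that show False by linarith
      qed
      then have "{n. 1 \<le> n \<and> (\<Sum>k=1..n. T k \<omega>) \<le> t} \<subseteq> {..N}" by blast
      then show "finite {n. 1 \<le> n \<and> (\<Sum>k=1..n. T k \<omega>) \<le> t}"
        by (rule finite_subset) simp
    qed
  qed
qed

text \<open>Between renewals the surplus increases at rate \<open>c\<close>, so ruin at time
  \<open>t\<close> already shows at the latest renewal epoch up to \<open>t\<close>, and the count
  at the \<open>n\<close>-th epoch is \<open>n\<close>. Finiteness makes the cardinality in
  \<open>renewal_count\<close> meaningful.\<close>

lemma ruin_event_iff:
  fixes U T :: "nat \<Rightarrow> 'a \<Rightarrow> real"
  assumes u: "0 < u" and c: "0 < c" and pos: "\<And>k. 1 \<le> k \<Longrightarrow> 0 < T k \<omega>"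
    and fin: "\<And>t. finite {n. 1 \<le> n \<and> (\<Sum>k=1..n. T k \<omega>) \<le> t}"
  shows "(\<exists>t\<ge>0. u + c * t - (\<Sum>k=1..renewal_count T \<omega> t. U k \<omega>) < 0) \<longleftrightarrow>
    (\<exists>n\<ge>1. (\<Sum>k=1..n. U k \<omega> - c * T k \<omega>) > u)"
proof -
  define S where "S n = (\<Sum>k=1..n. T k \<omega>)" for n
  have "S n < S (Suc n)" for n using pos[of "Suc n"] by (simp add: S_def)
  then have mono: "strict_mono S" by (simp add: strict_mono_Suc_iff)
  have walk: "(\<Sum>k=1..n. U k \<omega> - c * T k \<omega>) = (\<Sum>k=1..n. U k \<omega>) - c * S n" for n
    by (simp add: sum_subtractf sum_distrib_left S_def)
  have count_S: "renewal_count T \<omega> (S n) = n" for n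
  proof -
    have "{m. 1 \<le> m \<and> (\<Sum>k=1..m. T k \<omega>) \<le> S n} = {1..n}"
      using strict_mono_less_eq[OF mono] by (auto simp: S_def)
    then show ?thesis by (simp add: renewal_count_def)
  qed
  have S_count: "S (renewal_count T \<omega> t) \<le> t" if t: "0 \<le> t" for t
  \<comment> \<open>Without a renewal up to \<open>t\<close> the count is 0 and
    \<open>S 0 = 0\<close>, hence the condition \<open>0 \<le> t\<close>.\<close>
  proof (cases "{m. 1 \<le> m \<and> S m \<le> t} = {}")
    case True
    then have "renewal_count T \<omega> t = 0" unfolding renewal_count_def S_def[symmetric] by (simp only: card.empty)
    then show ?thesis using t by (simp add: S_def)
  next
    case False
    let ?A = "{m. 1 \<le> m \<and> S m \<le> t}"
    have A: "finite ?A" using fin[of t] by (simp add: S_def)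
    then have Max: "Max ?A \<in> ?A" using False by (rule Max_in)
    \<comment> \<open>As \<open>S\<close> increases, the indices of epochs up to \<open>t\<close>
      form an initial segment, so their number is the largest of them.\<close>
    have "?A = {1..Max ?A}"
    proof
      show "?A \<subseteq> {1..Max ?A}" using A by auto
      show "{1..Max ?A} \<subseteq> ?A"
      proof
        fix m assume m: "m \<in> {1..Max ?A}"
        then have "S m \<le> S (Max ?A)" using strict_mono_less_eq[OF mono] by simp
        with m Max show "m \<in> ?A" by simp
      qed
    qed
    then have "card ?A = Max ?A" by (metis card_atLeastAtMost diff_Suc_1 One_nat_def)
    then have "renewal_count T \<omega> t = Max ?A" by (simp add: renewal_count_def S_def)
    then show ?thesis using Max by simp
  qed
  show ?thesis
  proof
    assume "\<exists>t\<ge>0. u + c * t - (\<Sum>k=1..renewal_count T \<omega> t. U k \<omega>) < 0"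
    then obtain t where t: "0 \<le> t" "u + c * t - (\<Sum>k=1..renewal_count T \<omega> t. U k \<omega>) < 0" by blast
    let ?n = "renewal_count T \<omega> t"
    have "c * S ?n \<le> c * t" using S_count[OF t(1)] c by simp
    \<comment> \<open>A count of 0 would leave the positive surplus
      \<open>u + c * t\<close>.\<close>
    moreover have "0 < u + c * t" using t(1) u c by (simp add: add_pos_nonneg)
    with t(2) have "?n \<noteq> 0" by (intro notI) simp
    ultimately show "\<exists>n\<ge>1. (\<Sum>k=1..n. U k \<omega> - c * T k \<omega>) > u"
      using t unfolding walk by (intro exI[of _ ?n]) auto
  next
    assume "\<exists>n\<ge>1. (\<Sum>k=1..n. U k \<omega> - c * T k \<omega>) > u"
    then obtain n where n: "1 \<le> n" "(\<Sum>k=1..n. U k \<omega>) - c * S n > u" unfolding walk by blast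
    have "0 \<le> S n" unfolding S_def
      by (rule sum_nonneg) (simp add: pos order_less_imp_le)
    then show "\<exists>t\<ge>0. u + c * t - (\<Sum>k=1..renewal_count T \<omega> t. U k \<omega>) < 0"
      using n by (intro exI[of _ "S n"]) (simp add: count_S)
  qed
qed

text \<open>Ruin can only occur at time 0 or at a renewal epoch, even on the exceptional set where
  the waiting times are not positive; this removes the uncountable union over time.\<close>

lemma sets_ruin_event:
  fixes U T :: "nat \<Rightarrow> 'a \<Rightarrow> real"
  assumes u: "0 < u" and c: "0 < c"
    and U [measurable]: "\<And>k. 1 \<le> k \<Longrightarrow> U k \<in> borel_measurable M"
    and T [measurable]: "\<And>k. 1 \<le> k \<Longrightarrow> T k \<in> borel_measurable M"
  shows "{\<omega>\<in>space M. \<exists>t\<ge>0. u + c * t - (\<Sum>k=1..renewal_count T \<omega> t. U k \<omega>) < 0} \<in> sets M"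
proof -
  define S where "S n \<omega> = (\<Sum>k=1..n. T k \<omega>)" for n \<omega>
  have S [measurable]: "S n \<in> borel_measurable M" for n
    unfolding S_def by (rule borel_measurable_sum) simp
  have R: "(\<lambda>\<omega>. \<Sum>k=1..n. U k \<omega>) \<in> borel_measurable M" for n
    by (rule borel_measurable_sum) simp
  \<comment> \<open>The maximum with 0 turns every partial sum into an admissible time, also where
    it is negative; \<open>n = 0\<close> gives time 0.\<close>
  have count: "(\<lambda>\<omega>. renewal_count T \<omega> (max 0 (S n \<omega>))) \<in> measurable M (count_space UNIV)" for n
  proof -
    have "{\<omega>\<in>space M. m \<in> {m. 1 \<le> m \<and> S m \<omega> \<le> max 0 (S n \<omega>)}} \<in> sets M" for m
      unfolding mem_Collect_eq by measurable
    then show ?thesis unfolding renewal_count_def S_def[symmetric] by (rule measurable_card)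
  qed
  have claims: "(\<lambda>\<omega>. \<Sum>k=1..renewal_count T \<omega> (max 0 (S n \<omega>)). U k \<omega>) \<in> borel_measurable M" for n
    by (rule measurable_compose_countable[OF R count])
  have "(\<exists>t\<ge>0. u + c * t - (\<Sum>k=1..renewal_count T \<omega> t. U k \<omega>) < 0) \<longleftrightarrow>
      (\<exists>n. u + c * max 0 (S n \<omega>) - (\<Sum>k=1..renewal_count T \<omega> (max 0 (S n \<omega>)). U k \<omega>) < 0)"
    (is "?L \<longleftrightarrow> ?R") for \<omega>
  proof
    assume ?L
    then obtain t where t: "0 \<le> t" "u + c * t - (\<Sum>k=1..renewal_count T \<omega> t. U k \<omega>) < 0" by blast
    let ?A = "{m. 1 \<le> m \<and> S m \<omega> \<le> t}"
    have "0 < u + c * t" using t(1) u c by (simp add: add_pos_nonneg)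
    \<comment> \<open>An infinite or empty \<open>?A\<close> has cardinality 0 and hence no claims,
      so ruin forces it to be finite and nonempty.\<close>
    with t(2) have "renewal_count T \<omega> t \<noteq> 0" by (intro notI) simp
    then have A: "finite ?A" "?A \<noteq> {}"
      unfolding renewal_count_def S_def by (auto simp: card_eq_0_iff)
    then have "Max ((\<lambda>m. S m \<omega>) ` ?A) \<in> (\<lambda>m. S m \<omega>) ` ?A" by (intro Max_in) auto
    then obtain n where n: "n \<in> ?A" and n_Max: "Max ((\<lambda>m. S m \<omega>) ` ?A) = S n \<omega>" by (elim imageE)
    have max: "S m \<omega> \<le> S n \<omega>" if "m \<in> ?A" for m
      unfolding n_Max[symmetric] using A that by (intro Max_ge) auto
    \<comment> \<open>Moving \<open>t\<close> back to the largest epoch in \<open>?A\<close>, or to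
      0, leaves the count unchanged and can only lower the premium income.\<close>
    have "{m. 1 \<le> m \<and> S m \<omega> \<le> max 0 (S n \<omega>)} = ?A"
    proof (intro set_eqI iffI)
      fix m assume "m \<in> {m. 1 \<le> m \<and> S m \<omega> \<le> max 0 (S n \<omega>)}"
      then show "m \<in> ?A" using n t(1) by auto
    next
      fix m assume "m \<in> ?A"
      then show "m \<in> {m. 1 \<le> m \<and> S m \<omega> \<le> max 0 (S n \<omega>)}" using max[of m] by auto
    qed
    then have "renewal_count T \<omega> (max 0 (S n \<omega>)) = renewal_count T \<omega> t"
      by (simp add: renewal_count_def S_def)
    moreover have "c * max 0 (S n \<omega>) \<le> c * t" using n t(1) c by simp
    ultimately have "u + c * max 0 (S n \<omega>) - (\<Sum>k=1..renewal_count T \<omega> (max 0 (S n \<omega>)). U k \<omega>) < 0"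
      using t(2) by simp
    then show ?R ..
  next
    assume ?R
    then show ?L by (metis max.cobounded1)
  qed
  moreover have "{\<omega>\<in>space M. \<exists>n. u + c * max 0 (S n \<omega>) - (\<Sum>k=1..renewal_count T \<omega> (max 0 (S n \<omega>)). U k \<omega>) < 0} \<in> sets M"
    using claims by measurable
  ultimately show ?thesis by simp
qed

section \<open>Optimality of the tilted law in the renewal risk model\<close>

theorem proposition3p4:
  fixes M :: "'a measure" and U T :: "nat \<Rightarrow> 'a \<Rightarrow> real"
    and \<nu> h lam c w :: real and \<kappa> :: "real \<Rightarrow> ereal"
  assumes "prob_space M"
    and "0 < \<nu>" and "\<nu> < 1" and "0 < h" and "0 < lam" and "0 < c"
    and T_indep: "prob_space.indep_vars M (\<lambda>_. borel) T {1..}"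
    and T_density: "\<And>n. 1 \<le> n \<Longrightarrow>
          distributed M lborel (T n) (\<lambda>t. ennreal (waiting_density \<nu> h lam t))"
    and U_indep: "prob_space.indep_vars M (\<lambda>_. borel) U {1..}"
    and U_ident: "\<And>k. 1 \<le> k \<Longrightarrow> distr M borel (U k) = distr M borel (U 1)"
    and U_pos: "\<And>k. 1 \<le> k \<Longrightarrow> AE \<omega> in M. 0 < U k \<omega>"
    and UT_indep: "prob_space.indep_var M
          (\<Pi>\<^sub>M k\<in>{1..}. borel) (\<lambda>\<omega>. \<lambda>k\<in>{1..}. U k \<omega>)
          (\<Pi>\<^sub>M n\<in>{1..}. borel) (\<lambda>\<omega>. \<lambda>n\<in>{1..}. T n \<omega>)"
    and \<kappa>_eq: "\<And>\<theta>. \<kappa> \<theta> = log_mgf M (U 1) \<theta> + log_mgf M (T 1) (- c * \<theta>)"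
    and w: "w \<in> {0<..} \<inter> interior {\<theta>. \<kappa> \<theta> < \<infinity>}" "\<kappa> w = 0"
  shows "(\<forall>u>0. ruin_probability M c U T u =
            measure M {\<omega> \<in> space M. \<exists>n\<ge>1. (\<Sum>k=1..n. U k \<omega> - c * T k \<omega>) > u}) \<and>
         asymptotically_optimal c (distr M borel (U 1) \<Otimes>\<^sub>M distr M borel (T 1))
           (ruin_probability M c U T)
           (tilted_law M (U 1) w \<Otimes>\<^sub>M tilted_law M (T 1) (- c * w))"
proof -
  interpret prob_space M by fact
  have c: "0 < c" by fact
  have U_meas [measurable]: "1 \<le> k \<Longrightarrow> U k \<in> borel_measurable M" for k
    using U_indep by (auto simp: indep_vars_def2)
  have T_meas [measurable]: "1 \<le> k \<Longrightarrow> T k \<in> borel_measurable M" for k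
    using T_indep by (auto simp: indep_vars_def2)
  have U1 [measurable]: "U 1 \<in> borel_measurable M" and T1 [measurable]: "T 1 \<in> borel_measurable M"
    by (simp_all add: U_meas T_meas)
  define \<mu> where "\<mu> = distr M borel (U 1)"
  define \<tau> where "\<tau> = distr M borel (T 1)"
  have sets_\<mu> [measurable_cong, simp]: "sets \<mu> = sets borel" and sets_\<tau> [measurable_cong, simp]: "sets \<tau> = sets borel"
    by (simp_all add: \<mu>_def \<tau>_def)
  interpret \<mu>: prob_space \<mu> unfolding \<mu>_def by (rule prob_space_distr[OF U1])
  interpret \<tau>: prob_space \<tau> unfolding \<tau>_def by (rule prob_space_distr[OF T1])
  interpret P: pair_prob_space \<mu> \<tau> ..
  let ?P = "\<mu> \<Otimes>\<^sub>M \<tau>"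
  have sets_P: "sets ?P = sets (borel \<Otimes>\<^sub>M borel)" by (rule sets_pair_measure_cong) simp_all

  have T_law: "distr M borel (T n) = density lborel (\<lambda>t. ennreal (waiting_density \<nu> h lam t))"
    if "1 \<le> n" for n
    using distributed_distr_eq_density[OF T_density[OF that]] by (simp cong: distr_cong)
  then have T_ident: "distr M borel (T n) = distr M borel (T 1)" if "1 \<le> n" for n
    using that by simp
  have \<tau>_eq: "\<tau> = density lborel (\<lambda>t. ennreal (waiting_density \<nu> h lam t))"
    unfolding \<tau>_def by (rule T_law) simp
  have dens_meas: "(\<lambda>t. ennreal (waiting_density \<nu> h lam t)) \<in> borel_measurable lborel"
    using distributed_borel_measurable[OF T_density[of 1]] by simp
  have T_pos: "AE \<omega> in M. 0 < T k \<omega>" if k: "1 \<le> k" for k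
  proof -
    \<comment> \<open>The indicator in \<open>waiting_density\<close> confines the law to the
      positive half-line.\<close>
    have "AE t in distr M borel (T k). 0 < t"
      unfolding T_law[OF k]
      by (subst AE_density[OF dens_meas]) (auto simp: waiting_density_def indicator_def)
    then show ?thesis using k by (subst (asm) AE_distr_iff) auto
  qed
  have \<tau>_pos: "AE t in \<tau>. 0 < t"
    unfolding \<tau>_def using T_pos[of 1] by (subst AE_distr_iff) auto
  have \<mu>_pos: "AE x in \<mu>. 0 < x"
    unfolding \<mu>_def using U_pos[of 1] by (subst AE_distr_iff) auto
  have \<tau>_no_atom: "AE t in \<tau>. t \<noteq> a" for a
  proof -
    have "AE t in lborel. t \<noteq> a" by (rule AE_lborel_singleton)
    then show ?thesis unfolding \<tau>_eq by (subst AE_density[OF dens_meas]) auto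
  qed

  \<comment> \<open>The product form of the pair law factorises the moment generating function,
    which links \<open>\<kappa>\<close> to the Lundberg equation for one pair.\<close>
  have mgf: "(\<integral>\<^sup>+p. ennreal (exp (\<theta> * net_claim c p)) \<partial>?P) =
      (\<integral>\<^sup>+\<omega>. ennreal (exp (\<theta> * U 1 \<omega>)) \<partial>M) * (\<integral>\<^sup>+\<omega>. ennreal (exp (- c * \<theta> * T 1 \<omega>)) \<partial>M)" for \<theta>
  proof -
    have "(\<integral>\<^sup>+p. ennreal (exp (\<theta> * net_claim c p)) \<partial>?P) =
        (\<integral>\<^sup>+p. ennreal (exp (\<theta> * fst p)) * ennreal (exp (- c * \<theta> * snd p)) \<partial>?P)"
      by (intro nn_integral_cong)
         (simp add: net_claim_def ennreal_mult[symmetric] exp_add[symmetric] algebra_simps)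
    also have "\<dots> = (\<integral>\<^sup>+x. ennreal (exp (\<theta> * x)) \<partial>\<mu>) * (\<integral>\<^sup>+t. ennreal (exp (- c * \<theta> * t)) \<partial>\<tau>)"
      by (rule nn_integral_Pair_mult) (auto intro: \<tau>.sigma_finite_measure_axioms)
    also have "\<dots> = (\<integral>\<^sup>+\<omega>. ennreal (exp (\<theta> * U 1 \<omega>)) \<partial>M) * (\<integral>\<^sup>+\<omega>. ennreal (exp (- c * \<theta> * T 1 \<omega>)) \<partial>M)"
      unfolding \<mu>_def \<tau>_def by (simp add: nn_integral_distr)
    finally show ?thesis .
  qed

  obtain a b where
    ab: "(\<integral>\<^sup>+\<omega>. ennreal (exp (w * U 1 \<omega>)) \<partial>M) = ennreal a"
      "(\<integral>\<^sup>+\<omega>. ennreal (exp (- c * w * T 1 \<omega>)) \<partial>M) = ennreal b" "0 < a" "0 < b"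
    and log_ab: "log_mgf M (U 1) w = ereal (ln a)" "log_mgf M (T 1) (- c * w) = ereal (ln b)" "ln a + ln b = 0"
    using elog_add_eq_0[OF w(2)[unfolded \<kappa>_eq log_mgf_def]] unfolding log_mgf_def by metis
  \<comment> \<open>In terms of the two real moments, \<open>\<kappa> w = 0\<close> becomes
    \<open>a * b = 1\<close>, the condition \<open>mgf_w\<close> of the locale.\<close>
  have "ln (a * b) = 0" using ab log_ab by (simp add: ln_mult)
  then have "a * b = 1" using ab by simp
  interpret L: lundberg_tilting ?P c w
  proof
    show "(\<integral>\<^sup>+p. ennreal (exp (w * net_claim c p)) \<partial>?P) = 1"
      unfolding mgf ab using \<open>a * b = 1\<close> ab(3,4) by (simp add: ennreal_mult[symmetric])
  qed (use w sets_P in auto)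

  \<comment> \<open>The normalising constants contribute \<open>ln a + ln b = 0\<close>, so the
    product of the two tilted laws has density \<open>exp (w * net_claim c p)\<close>.\<close>
  have tilted: "tilted_law M (U 1) w \<Otimes>\<^sub>M tilted_law M (T 1) (- c * w) = L.Q"
  proof -
    let ?f = "\<lambda>x. ennreal (exp (w * x - ln a))" and ?g = "\<lambda>t. ennreal (exp (- c * w * t - ln b))"
    have U_tilt: "tilted_law M (U 1) w = density \<mu> ?f"
      unfolding tilted_law_def log_ab \<mu>_def by simp
    have T_tilt: "tilted_law M (T 1) (- c * w) = density \<tau> ?g"
      unfolding tilted_law_def log_ab \<tau>_def by simp
    have int_g: "(\<integral>\<^sup>+t. ?g t \<partial>\<tau>) = 1"
    proof -
      have "(\<integral>\<^sup>+t. ?g t \<partial>\<tau>) = (\<integral>\<^sup>+t. ennreal (1 / b) * ennreal (exp (- c * w * t)) \<partial>\<tau>)"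
        using ab(4) by (intro nn_integral_cong) (simp add: exp_diff ennreal_mult[symmetric])
      also have "\<dots> = ennreal (1 / b) * (\<integral>\<^sup>+t. ennreal (exp (- c * w * t)) \<partial>\<tau>)"
        by (rule nn_integral_cmult) measurable
      also have "(\<integral>\<^sup>+t. ennreal (exp (- c * w * t)) \<partial>\<tau>) = ennreal b"
        unfolding \<tau>_def ab(2)[symmetric] by (rule nn_integral_distr) measurable
      finally show ?thesis using ab(4) by (simp add: ennreal_mult[symmetric])
    qed
    \<comment> \<open>This supplies the sigma-finiteness that \<open>pair_measure_density\<close>
      demands.\<close>
    have "prob_space (density \<tau> ?g)"
    proof (rule prob_spaceI)
      have "emeasure (density \<tau> ?g) (space \<tau>) = (\<integral>\<^sup>+t. ?g t * indicator (space \<tau>) t \<partial>\<tau>)"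
        by (rule emeasure_density[OF _ sets.top]) measurable
      also have "\<dots> = (\<integral>\<^sup>+t. ?g t \<partial>\<tau>)" by (intro nn_integral_cong) simp
      finally show "emeasure (density \<tau> ?g) (space (density \<tau> ?g)) = 1" unfolding int_g by simp
    qed
    then have "density \<mu> ?f \<Otimes>\<^sub>M density \<tau> ?g = density ?P (\<lambda>(x, t). ?f x * ?g t)"
      by (intro pair_measure_density) (auto intro: \<tau>.sigma_finite_measure_axioms prob_space_imp_sigma_finite)
    also have "\<dots> = L.Q"
      unfolding L.Q_def
    proof (rule density_cong)
      show "AE p in ?P. (case p of (x, t) \<Rightarrow> ?f x * ?g t) = ennreal (exp (w * net_claim c p))"
      proof (rule AE_I2)
        fix p :: "real \<times> real"
        obtain x t where p: "p = (x, t)" by (cases p)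
        have "(w * x - ln a) + (- c * w * t - ln b) = w * net_claim c p"
          using log_ab(3) by (simp add: p net_claim_def algebra_simps)
        then show "(case p of (x, t) \<Rightarrow> ?f x * ?g t) = ennreal (exp (w * net_claim c p))"
          by (simp add: p ennreal_mult[symmetric] exp_add[symmetric])
      qed
    qed measurable
    finally show ?thesis unfolding U_tilt T_tilt .
  qed

  \<comment> \<open>For fixed \<open>x\<close> the net claim vanishes only at
    \<open>t = x / c\<close>, a null set because the waiting time has a Lebesgue density.\<close>
  have nondeg: "\<not> (AE p in ?P. net_claim c p = 0)"
  proof
    assume "AE p in ?P. net_claim c p = 0"
    then have "AE x in \<mu>. AE t in \<tau>. net_claim c (x, t) = 0" by (rule P.AE_pair)
    then have "AE x in \<mu>. False"
    proof eventually_elim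
      case (elim x)
      from elim \<tau>_no_atom[of "x / c"] have "AE t in \<tau>. False"
        by eventually_elim (use c in \<open>auto simp: net_claim_def field_simps\<close>)
      then show False by simp
    qed
    then show False by simp
  qed

  \<comment> \<open>Membership in the interior leaves room to the right of \<open>w\<close>; this is
    the exponential moment of the net claim under the tilted law.\<close>
  obtain e where e: "0 < e" and e_fin: "\<kappa> (w + e) < \<infinity>"
  proof -
    obtain r where r: "0 < r" "ball w r \<subseteq> {\<theta>. \<kappa> \<theta> < \<infinity>}"
      using w(1) mem_interior by blast
    moreover have "w + r / 2 \<in> ball w r" using r by (simp add: dist_real_def)
    ultimately show ?thesis by (intro that[of "r / 2"]) auto
  qed
  have fin: "(\<integral>\<^sup>+p. ennreal (exp ((w + e) * net_claim c p)) \<partial>?P) < \<infinity>"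
    unfolding mgf using elog_add_finite[OF e_fin[unfolded \<kappa>_eq log_mgf_def]]
    by (simp add: ennreal_mult_less_top)

  \<comment> \<open>The two events can differ only where some waiting time fails to be positive or
    infinitely many renewals accumulate, a null set.\<close>
  have ruin: "ruin_probability M c U T u =
      measure M {\<omega> \<in> space M. \<exists>n\<ge>1. (\<Sum>k=1..n. U k \<omega> - c * T k \<omega>) > u}" if u: "0 < u" for u
    unfolding ruin_probability_def
  proof (rule measure_eq_AE)
    have "AE \<omega> in M. \<forall>k\<in>{1..}. 0 < T k \<omega>"
      by (subst AE_ball_countable) (use T_pos in auto)
    moreover have "AE \<omega> in M. \<forall>t. finite {n. 1 \<le> n \<and> (\<Sum>k=1..n. T k \<omega>) \<le> t}"
      using T_indep T_ident T_pos by (rule AE_finite_renewals)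
    ultimately show "AE \<omega> in M. \<omega> \<in> {\<omega>\<in>space M. \<exists>t\<ge>0. u + c * t - (\<Sum>k=1..renewal_count T \<omega> t. U k \<omega>) < 0} \<longleftrightarrow>
        \<omega> \<in> {\<omega>\<in>space M. \<exists>n\<ge>1. (\<Sum>k=1..n. U k \<omega> - c * T k \<omega>) > u}"
    proof eventually_elim
      case (elim \<omega>)
      then show ?case using ruin_event_iff[OF u c, of T \<omega> U] by simp
    qed
    show "{\<omega>\<in>space M. \<exists>t\<ge>0. u + c * t - (\<Sum>k=1..renewal_count T \<omega> t. U k \<omega>) < 0} \<in> sets M"
      by (rule sets_ruin_event[OF u c U_meas T_meas])
    have [measurable]: "(\<lambda>\<omega>. \<Sum>k=1..n. U k \<omega> - c * T k \<omega>) \<in> borel_measurable M" for n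
      by (rule borel_measurable_sum) simp
    show "{\<omega>\<in>space M. \<exists>n\<ge>1. (\<Sum>k=1..n. U k \<omega> - c * T k \<omega>) > u} \<in> sets M"
      by measurable
  qed

  \<comment> \<open>The sequence of pairs on \<open>M\<close> has the law of the coordinates of the
    infinite product, on which \<open>estimator_mean\<close> is stated.\<close>
  have path_law: "distr M (\<Pi>\<^sub>M k\<in>{1..}. borel \<Otimes>\<^sub>M borel) (\<lambda>\<omega>. \<lambda>k\<in>{1..}. (U k \<omega>, T k \<omega>)) = (\<Pi>\<^sub>M k\<in>{1..}. ?P)"
  proof -
    have "indep_vars (\<lambda>_. borel \<Otimes>\<^sub>M borel) (\<lambda>k \<omega>. (U k \<omega>, T k \<omega>)) {1..}"
      by (rule indep_vars_Pair[OF U_indep T_indep UT_indep])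
    then have "distr M (\<Pi>\<^sub>M k\<in>{1..}. borel \<Otimes>\<^sub>M borel) (\<lambda>\<omega>. \<lambda>k\<in>{1..}. (U k \<omega>, T k \<omega>)) =
        (\<Pi>\<^sub>M k\<in>{1..}. distr M (borel \<Otimes>\<^sub>M borel) (\<lambda>\<omega>. (U k \<omega>, T k \<omega>)))"
      by (subst (asm) indep_vars_iff_distr_eq_PiM') auto
    also have "\<dots> = (\<Pi>\<^sub>M k\<in>{1..}. ?P)"
    proof (rule PiM_cong[OF refl])
      fix k :: nat assume k: "k \<in> {1..}"
      have "indep_var borel ((\<lambda>x. x k) \<circ> (\<lambda>\<omega>. \<lambda>k\<in>{1..}. U k \<omega>)) borel ((\<lambda>x. x k) \<circ> (\<lambda>\<omega>. \<lambda>k\<in>{1..}. T k \<omega>))"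
        by (rule indep_var_compose[OF UT_indep]) (use k in \<open>auto intro: measurable_component_singleton\<close>)
      then have "indep_var borel (U k) borel (T k)"
        using k by (simp add: comp_def)
      then have "distr M borel (U k) \<Otimes>\<^sub>M distr M borel (T k) = distr M (borel \<Otimes>\<^sub>M borel) (\<lambda>\<omega>. (U k \<omega>, T k \<omega>))"
        unfolding indep_var_distribution_eq by blast
      then show "distr M (borel \<Otimes>\<^sub>M borel) (\<lambda>\<omega>. (U k \<omega>, T k \<omega>)) = ?P"
        using k U_ident[of k] T_ident[of k] by (simp add: \<mu>_def \<tau>_def)
    qed
    finally show ?thesis .
  qed

  \<comment> \<open>Unbiasedness is carried from the product space to \<open>M\<close>, so that the
    first-moment rate becomes the rate of the ruin probability.\<close>
  have mean: "(\<integral>\<^sup>+x. importance_estimator c ?P L.Q u x \<partial>L.path_Q) = ennreal (ruin_probability M c U T u)"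
    if u: "0 < u" for u
  proof -
    let ?D = "\<lambda>\<omega>. \<lambda>k\<in>{1..}. (U k \<omega>, T k \<omega>)" and ?B = "\<Pi>\<^sub>M k\<in>{1::nat..}. (borel \<Otimes>\<^sub>M borel :: (real \<times> real) measure)"
    let ?A = "{x\<in>space (\<Pi>\<^sub>M k\<in>{1::nat..}. ?P). \<exists>n\<ge>1. u < (\<Sum>k=1..n. net_claim c (x k))}"
    have D: "?D \<in> measurable M ?B"
      by (rule measurable_restrict) simp
    have walk: "(\<lambda>x. \<Sum>k=1..n. net_claim c (x k)) \<in> borel_measurable (\<Pi>\<^sub>M k\<in>{1::nat..}. ?P)" for n
      by (rule L.measurable_walk) (use sets_P in auto)
    have "?A \<in> sets (\<Pi>\<^sub>M k\<in>{1::nat..}. ?P)"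
      by (intro sets.sets_Collect_countable_Ex sets.sets_Collect_conj sets.sets_Collect_const
          borel_measurable_less borel_measurable_const walk)
    then have A: "?A \<in> sets ?B" unfolding path_law[symmetric] by simp
    have "(\<integral>\<^sup>+x. importance_estimator c ?P L.Q u x \<partial>L.path_Q) = emeasure (\<Pi>\<^sub>M k\<in>{1::nat..}. ?P) ?A"
      by (rule L.estimator_mean)
    also have "\<dots> = emeasure (distr M ?B ?D) ?A" by (simp only: path_law)
    also have "\<dots> = emeasure M (?D -` ?A \<inter> space M)" by (rule emeasure_distr[OF D A])
    also have "?D -` ?A \<inter> space M = {\<omega>\<in>space M. \<exists>n\<ge>1. (\<Sum>k=1..n. U k \<omega> - c * T k \<omega>) > u}"
    proof -
      have "?D \<omega> \<in> space (\<Pi>\<^sub>M k\<in>{1::nat..}. ?P)" if "\<omega> \<in> space M" for \<omega>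
        using measurable_space[OF D that] unfolding path_law[symmetric] by simp
      moreover have "(\<Sum>k=1..n. net_claim c (?D \<omega> k)) = (\<Sum>k=1..n. U k \<omega> - c * T k \<omega>)" for n \<omega>
        by (intro sum.cong) (auto simp: net_claim_def)
      ultimately show ?thesis by auto
    qed
    finally show ?thesis by (simp only: emeasure_eq_measure ruin[OF u])
  qed

  have "importance_sampling_law ?P L.Q"
    unfolding importance_sampling_law_def
  proof (intro conjI)
    show "emeasure L.Q ({0<..} \<times> {0<..}) = 1"
    proof -
      interpret Q: prob_space L.Q by (rule L.prob_Q)
      have "AE p in ?P. p \<in> {0<..} \<times> {0<..}"
      proof (rule P.AE_pair_measure)
        show "{p \<in> space ?P. p \<in> {0<..} \<times> {0<..}} \<in> sets ?P" by measurable
        show "AE x in \<mu>. AE t in \<tau>. (x, t) \<in> {0<..} \<times> {0<..}"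
          using \<mu>_pos by eventually_elim (use \<tau>_pos in auto)
      qed
      \<comment> \<open>Passing to a density preserves almost sure statements, so positivity carries
        over to the tilted law.\<close>
      then have "AE p in L.Q. p \<in> {0<..} \<times> {0<..}"
        unfolding L.Q_def by (subst AE_density) auto
      then show ?thesis by (intro Q.emeasure_eq_1_AE) auto
    qed
  qed (auto intro: L.prob_Q L.absolutely_continuous_Q)
  moreover have "((\<lambda>u. elog (ennreal (ruin_probability M c U T u)) / ereal u) \<longlongrightarrow> ereal (- w)) at_top"
  proof (rule Lim_transform_eventually)
    show "((\<lambda>u. elog (\<integral>\<^sup>+x. importance_estimator c ?P L.Q u x ^ 1 \<partial>L.path_Q) / ereal u) \<longlongrightarrow> ereal (- w)) at_top"
      using L.estimator_moment_rate[OF _ nondeg e fin, of 1] by simp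
    show "\<forall>\<^sub>F u in at_top. elog (\<integral>\<^sup>+x. importance_estimator c ?P L.Q u x ^ 1 \<partial>L.path_Q) / ereal u =
        elog (ennreal (ruin_probability M c U T u)) / ereal u"
      using eventually_gt_at_top[of 0] by eventually_elim (simp only: power_one_right mean)
  qed
  \<comment> \<open>The second moment is the case \<open>p = 2\<close>, hence exactly twice the rate
    of the ruin probability.\<close>
  moreover have "((\<lambda>u. elog (importance_second_moment c ?P L.Q u) / ereal u) \<longlongrightarrow> 2 * ereal (- w)) at_top"
    using L.estimator_moment_rate[OF _ nondeg e fin, of 2] unfolding importance_second_moment_def by simp
  ultimately have "asymptotically_optimal c ?P (ruin_probability M c U T) L.Q"
    unfolding asymptotically_optimal_def by blast
  then show ?thesis using ruin unfolding tilted \<mu>_def \<tau>_def by blast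
qed

end
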